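(* Let $\gamma\in(0,\min\{d,2\})$ and let $\mu,\nu$ be compactly supported probability distributions on $\mathbb R^d$. Then $$\mathcal E_\gamma(\mu,\nu)=(2\pi)^{d/2}\sqrt{F_\gamma(d)}\;\big\|I_{\frac{d+\gamma}2}(\mu-\nu)\big\|_2,\qquad F_\gamma(d)=\frac{\gamma\,2^{\gamma-1}\,\Gamma\left(\frac{d+\gamma}2\right)}{\pi^{d/2}\,\Gamma(1-\frac\gamma2)} .$$
   Context: For $0<s<d$, the Riesz potential of a compactly supported finite signed measure $f$ on $\mathbb R^d$ is (in the weak sense) $I_sf=f*K_s$, where $K_s(x)=c_s^{-1}\|x\|^{s-d}$ and $c_s=\pi^{d/2}\,2^s\,\Gamma(s/2)/\Gamma((d-s)/2)$. $\|\cdot\|_2$ is the $L^2(\mathbb R^d)$ norm. The generalized energy distance $\mathcal E_\gamma(\mu,\nu)\ge0$ is given by $\mathcal E_\gamma^2(\mu,\nu)=\mathbb E\big[2\|X-Y\|^\gamma-\|X-X'\|^\gamma-\|Y-Y'\|^\gamma\big]$ with $(X,X',Y,Y')\sim\mu^{\otimes2}\otimes\nu^{\otimes2}$. *)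

theory Defs
  imports "HOL-Probability.Probability"
begin

definition compactly_supported :: "'a::euclidean_space measure \<Rightarrow> bool" where
  "compactly_supported M \<longleftrightarrow> (\<exists>K. compact K \<and> (AE x in M. x \<in> K))"

definition riesz_const :: "nat \<Rightarrow> real \<Rightarrow> real" where
  "riesz_const d s = pi powr (real d / 2) * 2 powr s * Gamma (s / 2) / Gamma ((real d - s) / 2)"

text \<open>
  At the singularity \<open>x = 0\<close> the kernel takes the junk value 0. This affects the potential below
  only at the atoms of the two measures, hence only on a countable set.
\<close>

definition riesz_kernel :: "real \<Rightarrow> 'a::euclidean_space \<Rightarrow> real" where
  "riesz_kernel s x = inverse (riesz_const DIM('a) s) * norm x powr (s - real DIM('a))"

text \<open>
  The Riesz potential of the finite signed measure \<open>M - N\<close>, where a finite signed measure is given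
  as a difference of two finite measures. The convolution integrals converge for almost every \<open>x\<close>
  (\<open>AE_integrable_riesz_kernel\<close>), and the function so defined represents the distributional
  convolution (\<open>riesz_potential_weak\<close>).
\<close>

definition riesz_potential ::
  "real \<Rightarrow> 'a::euclidean_space measure \<Rightarrow> 'a measure \<Rightarrow> 'a \<Rightarrow> real" where
  "riesz_potential s M N x =
     (\<integral>y. riesz_kernel s (x - y) \<partial>M) - (\<integral>y. riesz_kernel s (x - y) \<partial>N)"

text \<open>
  Being a real-valued Bochner integral, this is the \<open>L\<^sup>2\<close> norm only for square-integrable \<open>f\<close>.
\<close>

definition L2_norm :: "('a::euclidean_space \<Rightarrow> real) \<Rightarrow> real" where
  "L2_norm f = sqrt (\<integral>x. (f x)\<^sup>2 \<partial>lborel)"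

definition energy_distance ::
  "real \<Rightarrow> 'a::euclidean_space measure \<Rightarrow> 'a measure \<Rightarrow> real" where
  "energy_distance \<gamma> M N = sqrt (\<integral>((x, x'), (y, y')).
     2 * norm (x - y) powr \<gamma> - norm (x - x') powr \<gamma> - norm (y - y') powr \<gamma>
     \<partial>((M \<Otimes>\<^sub>M M) \<Otimes>\<^sub>M (N \<Otimes>\<^sub>M N)))"

definition F_const :: "real \<Rightarrow> nat \<Rightarrow> real" where
  "F_const \<gamma> d = \<gamma> * 2 powr (\<gamma> - 1) * Gamma ((real d + \<gamma>) / 2)
     / (pi powr (real d / 2) * Gamma (1 - \<gamma> / 2))"

lemma borel_measurable_riesz_kernel [measurable]:
  "riesz_kernel s \<in> borel_measurable (borel :: 'a::euclidean_space measure)"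
  unfolding riesz_kernel_def by measurable

lemma nn_integral_norm_powr_cball_finite:
  assumes s: "0 < s" and a: "a = s - real DIM('a)" and neg: "a < 0"
  shows "(\<integral>\<^sup>+x. ennreal (norm (x::'a::euclidean_space) powr a) * indicator (cball 0 1) x \<partial>lborel) < \<infinity>"
proof -
  define r where "r k = (1/2 :: real) ^ k" for k :: nat
  have r_pos: "r k > 0" for k by (simp add: r_def)
  define V where "V = unit_ball_vol (real DIM('a))"
  have V: "V \<ge> 0" by (simp add: V_def)
  have single: "f k \<le> suminf f" for f :: "nat \<Rightarrow> ennreal" and k
    using sum_le_suminf[of f "{k}"] by simp
  have pt: "ennreal (norm x powr a) * indicator (cball 0 1) x
      \<le> (\<Sum>k. ennreal (r (Suc k) powr a) * indicator (cball 0 (r k)) x)" for x :: 'a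
  proof (cases "x \<noteq> 0 \<and> norm x \<le> 1")
    case True
    then have x: "norm x > 0" "norm x \<le> 1" by auto
    define k where "k = (LEAST j. r (Suc j) < norm x)"
    obtain j0 where "(1/2 :: real) ^ j0 < norm x"
      using real_arch_pow_inv[of "norm x" "1/2"] x by auto
    moreover have "r (Suc j0) \<le> (1/2) ^ j0" by (simp add: r_def)
    ultimately have ex: "r (Suc j0) < norm x" by linarith
    have k1: "r (Suc k) < norm x" unfolding k_def by (rule LeastI[where P = "\<lambda>j. r (Suc j) < norm x", OF ex])
    have k2: "norm x \<le> r k"
    proof (cases k)
      case 0
      then show ?thesis using x by (simp add: r_def)
    next
      case (Suc m)
      then have "\<not> r (Suc m) < norm x"
        unfolding k_def using not_less_Least[of m "\<lambda>j. r (Suc j) < norm x"] by linarith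
      then show ?thesis using Suc by simp
    qed
    have "norm x powr a \<le> r (Suc k) powr a"
      using neg k1 r_pos[of "Suc k"] by (intro powr_mono2') auto
    then have "ennreal (norm x powr a) * indicator (cball 0 1) x
        \<le> ennreal (r (Suc k) powr a) * indicator (cball 0 (r k)) x"
      using x k2 by (simp add: ennreal_leI)
    also have "\<dots> \<le> (\<Sum>k. ennreal (r (Suc k) powr a) * indicator (cball 0 (r k)) x)"
      by (rule single)
    finally show ?thesis .
  qed (auto simp: indicator_def)
  have tm: "r (Suc k) powr a * (V * r k ^ DIM('a)) = V * (1/2) powr a * ((1/2) powr s) ^ k" for k
  proof -
    have "r (Suc k) powr a = (1/2) powr (a * real (Suc k))"
      by (simp add: r_def powr_realpow[symmetric] powr_powr mult.commute del: power_Suc)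
    moreover have "r k ^ DIM('a) = (1/2) powr (real DIM('a) * real k)"
      by (simp add: r_def powr_realpow[symmetric] powr_powr mult.commute)
    moreover have "((1/2) powr s) ^ k = (1/2) powr (s * real k)"
      by (simp add: powr_realpow[symmetric] powr_powr)
    moreover have "a * real (Suc k) + real DIM('a) * real k = a + s * real k"
      by (simp add: a algebra_simps)
    ultimately show ?thesis
      by (simp add: powr_add[symmetric] mult.assoc mult.left_commute[of _ V])
  qed
  have lt1: "(1/2 :: real) powr s < 1"
    using s powr_less_mono2[of s "1/2" 1] by simp
  have summ: "summable (\<lambda>k. V * (1/2) powr a * ((1/2) powr s) ^ k)"
    using lt1 by (intro summable_mult summable_geometric) simp
  have "(\<integral>\<^sup>+x. ennreal (norm (x::'a) powr a) * indicator (cball 0 1) x \<partial>lborel)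
      \<le> (\<integral>\<^sup>+x. (\<Sum>k. ennreal (r (Suc k) powr a) * indicator (cball (0::'a) (r k)) x) \<partial>lborel)"
    by (intro nn_integral_mono pt)
  also have "\<dots> = (\<Sum>k. \<integral>\<^sup>+x. ennreal (r (Suc k) powr a) * indicator (cball (0::'a) (r k)) x \<partial>lborel)"
    by (intro nn_integral_suminf borel_measurable_times_ennreal borel_measurable_const
        borel_measurable_indicator) auto
  also have "\<dots> = (\<Sum>k. ennreal (V * (1/2) powr a * ((1/2) powr s) ^ k))"
  proof (rule arg_cong[where f = suminf], rule ext)
    fix k
    have "(\<integral>\<^sup>+x. ennreal (r (Suc k) powr a) * indicator (cball (0::'a) (r k)) x \<partial>lborel)
        = ennreal (r (Suc k) powr a) * emeasure lborel (cball (0::'a) (r k))"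
      by (simp add: nn_integral_cmult_indicator)
    also have "\<dots> = ennreal (r (Suc k) powr a * (V * r k ^ DIM('a)))"
      using r_pos[of k] by (simp add: emeasure_cball V_def ennreal_mult)
    finally show "(\<integral>\<^sup>+x. ennreal (r (Suc k) powr a) * indicator (cball (0::'a) (r k)) x \<partial>lborel)
        = ennreal (V * (1/2) powr a * ((1/2) powr s) ^ k)"
      by (simp add: tm)
  qed
  also have "\<dots> < \<infinity>"
    using summ V by (subst suminf_ennreal2) auto
  finally show ?thesis .
qed

lemma integrable_riesz_kernel_pair:
  fixes M :: "'a::euclidean_space measure" and \<phi> :: "'a \<Rightarrow> real"
  assumes s: "0 < s" "s < real DIM('a)"
    and M: "finite_measure M" "sets M = sets borel"
    and \<phi> [measurable]: "\<phi> \<in> borel_measurable borel"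
    and B: "\<And>x. \<bar>\<phi> x\<bar> \<le> B" and R: "\<And>x. x \<notin> cball 0 R \<Longrightarrow> \<phi> x = 0"
  shows "integrable (lborel \<Otimes>\<^sub>M M) (\<lambda>(x, y). \<phi> x * riesz_kernel s (x - y))"
proof -
  interpret M: finite_measure M by fact
  interpret P: pair_sigma_finite lborel M ..
  note [measurable_cong] = M(2)
  define a where "a = s - real DIM('a)"
  define C where "C = \<bar>inverse (riesz_const DIM('a) s)\<bar>"
  define J where "J = (\<integral>\<^sup>+x. ennreal (norm (x::'a) powr a) * indicator (cball 0 1) x \<partial>lborel)"
  define W where "W = emeasure lborel (cball (0::'a) R)"
  have J: "J < \<infinity>"
    unfolding J_def using s by (intro nn_integral_norm_powr_cball_finite[of s]) (auto simp: a_def)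
  have W: "W < \<infinity>"
    unfolding W_def by (intro emeasure_bounded_finite) auto
  have B0: "B \<ge> 0" using B[of 0] by linarith
  have pt: "ennreal (norm (\<phi> x * riesz_kernel s (x - y))) \<le> ennreal (B * C) *
      (ennreal (norm (x - y) powr a) * indicator (cball y 1) x + indicator (cball 0 R) x)"
    for x y
  proof (cases "x \<in> cball 0 R")
    case True
    have "norm (x - y) powr a \<le> norm (x - y) powr a * indicator (cball y 1) x + 1"
    proof (cases "norm (x - y) \<le> 1")
      case False
      then have "norm (x - y) powr a \<le> 1"
        using powr_mono2'[of a 1 "norm (x - y)"] s by (simp add: a_def)
      then show ?thesis
        by (rule order_trans) (simp add: indicator_def)
    qed (simp add: dist_norm norm_minus_commute)
    moreover have "norm (\<phi> x * riesz_kernel s (x - y)) \<le> B * C * norm (x - y) powr a"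
      using B[of x] by (auto simp: riesz_kernel_def abs_mult a_def C_def mult.assoc intro!: mult_right_mono)
    ultimately have "norm (\<phi> x * riesz_kernel s (x - y)) \<le>
        B * C * (norm (x - y) powr a * indicator (cball y 1) x + 1)"
      using B0 by (smt (verit) C_def mult_left_mono mult_nonneg_nonneg abs_ge_zero)
    then have "ennreal (norm (\<phi> x * riesz_kernel s (x - y))) \<le>
        ennreal (B * C * (norm (x - y) powr a * indicator (cball y 1) x + 1))"
      by (rule ennreal_leI)
    also have "\<dots> = ennreal (B * C) *
      (ennreal (norm (x - y) powr a) * indicator (cball y 1) x + indicator (cball 0 R) x)"
      using True B0 by (subst ennreal_mult) (auto simp: C_def indicator_def)
    finally show ?thesis .
  qed (use R in simp)
  have inner: "(\<integral>\<^sup>+x. ennreal (norm (\<phi> x * riesz_kernel s (x - y))) \<partial>lborel)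
      \<le> ennreal (B * C) * (J + W)" for y
  proof -
    have [measurable]: "cball z q \<in> sets borel" for z :: 'a and q by simp
    have m: "(\<lambda>x. ennreal (norm (x - y) powr a) * indicator (cball y 1) x
        + indicator (cball 0 R) x) \<in> borel_measurable lborel"
      by measurable
    have "(\<integral>\<^sup>+x. ennreal (norm (\<phi> x * riesz_kernel s (x - y))) \<partial>lborel) \<le>
      (\<integral>\<^sup>+x. ennreal (B * C) * (ennreal (norm (x - y) powr a) * indicator (cball y 1) x
        + indicator (cball 0 R) x) \<partial>lborel)"
      by (intro nn_integral_mono pt)
    also have "\<dots> = ennreal (B * C) * ((\<integral>\<^sup>+x. ennreal (norm (x - y) powr a) *
        indicator (cball y 1) x \<partial>lborel) + W)"
      unfolding W_def nn_integral_cmult[OF m] by (subst nn_integral_add) auto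
    also have "(\<integral>\<^sup>+x. ennreal (norm (x - y) powr a) * indicator (cball y 1) x \<partial>lborel)
        = (\<integral>\<^sup>+x. ennreal (norm x powr a) * indicator (cball 0 1) x \<partial>distr lborel borel ((+) (- y)))"
      by (subst nn_integral_distr) (auto intro!: nn_integral_cong simp: indicator_def dist_norm norm_minus_commute)
    also have "\<dots> = J"
      unfolding J_def by (simp add: lborel_distr_plus)
    finally show ?thesis .
  qed
  have "(\<integral>\<^sup>+p. ennreal (norm ((\<lambda>(x, y). \<phi> x * riesz_kernel s (x - y)) p)) \<partial>(lborel \<Otimes>\<^sub>M M))
      = (\<integral>\<^sup>+y. \<integral>\<^sup>+x. ennreal (norm (\<phi> x * riesz_kernel s (x - y))) \<partial>lborel \<partial>M)"
    by (subst P.nn_integral_snd[symmetric]) (auto simp: case_prod_beta)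
  also have "\<dots> \<le> (\<integral>\<^sup>+y. ennreal (B * C) * (J + W) \<partial>M)"
    by (intro nn_integral_mono inner)
  also have "\<dots> < \<infinity>"
    using J W M.emeasure_finite[of "space M"]
    by (simp add: ennreal_mult_eq_top_iff less_top[symmetric])
  finally show ?thesis
    by (intro integrableI_bounded) auto
qed

lemma AE_integrable_riesz_kernel:
  fixes M :: "'a::euclidean_space measure"
  assumes s: "0 < s" "s < real DIM('a)" and M: "finite_measure M" "sets M = sets borel"
  shows "AE x in lborel. integrable M (\<lambda>y. riesz_kernel s (x - y))"
proof -
  interpret M: finite_measure M by fact
  interpret P: pair_sigma_finite lborel M ..
  have "AE x in lborel. integrable M (\<lambda>y. indicator (cball (0::'a) (real n)) x * riesz_kernel s (x - y))"
    for n :: nat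
    by (rule P.AE_integrable_fst, rule integrable_riesz_kernel_pair[where B = 1 and R = "real n"])
      (use s M in \<open>auto simp: indicator_def\<close>)
  then have "AE x in lborel. \<forall>n. integrable M
      (\<lambda>y. indicator (cball (0::'a) (real n)) x * riesz_kernel s (x - y))"
    by (subst AE_all_countable) blast
  then show ?thesis
  proof eventually_elim
    case (elim x)
    obtain n :: nat where "norm x \<le> real n" using real_arch_simple by blast
    then show ?case using elim[rule_format, of n] by simp
  qed
qed

text \<open>
  Pairing with test functions; bounded Borel functions of bounded support include the smooth
  compactly supported ones.
\<close>

lemma riesz_potential_weak:
  fixes M N :: "'a::euclidean_space measure" and \<phi> :: "'a \<Rightarrow> real"
  assumes s: "0 < s" "s < real DIM('a)"
    and M: "finite_measure M" "sets M = sets borel"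
    and N: "finite_measure N" "sets N = sets borel"
    and \<phi>: "\<phi> \<in> borel_measurable borel" "bounded (range \<phi>)" "bounded {x. \<phi> x \<noteq> 0}"
  shows "integrable lborel (\<lambda>x. \<phi> x * riesz_potential s M N x)"
    and "(\<integral>x. \<phi> x * riesz_potential s M N x \<partial>lborel) =
      (\<integral>y. (\<integral>x. \<phi> x * riesz_kernel s (x - y) \<partial>lborel) \<partial>M)
      - (\<integral>y. (\<integral>x. \<phi> x * riesz_kernel s (x - y) \<partial>lborel) \<partial>N)"
proof -
  obtain B where B: "\<And>x. \<bar>\<phi> x\<bar> \<le> B"
    using \<phi>(2) by (auto simp: bounded_iff)
  obtain R where "\<And>x. \<phi> x \<noteq> 0 \<Longrightarrow> norm x \<le> R"
    using \<phi>(3) by (auto simp: bounded_iff)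
  then have R: "\<And>x. x \<notin> cball 0 R \<Longrightarrow> \<phi> x = 0" by auto
  have *: "integrable lborel (\<lambda>x. \<phi> x * (\<integral>y. riesz_kernel s (x - y) \<partial>Q))"
    "(\<integral>x. \<phi> x * (\<integral>y. riesz_kernel s (x - y) \<partial>Q) \<partial>lborel) =
      (\<integral>y. (\<integral>x. \<phi> x * riesz_kernel s (x - y) \<partial>lborel) \<partial>Q)"
    if Q: "finite_measure Q" "sets Q = sets borel" for Q :: "'a measure"
  proof -
    interpret Q: finite_measure Q by fact
    interpret P: pair_sigma_finite lborel Q ..
    note int = integrable_riesz_kernel_pair[OF s Q \<phi>(1) B R]
    show "integrable lborel (\<lambda>x. \<phi> x * (\<integral>y. riesz_kernel s (x - y) \<partial>Q))"
      using P.integrable_fst[OF int] by simp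
    show "(\<integral>x. \<phi> x * (\<integral>y. riesz_kernel s (x - y) \<partial>Q) \<partial>lborel) =
      (\<integral>y. (\<integral>x. \<phi> x * riesz_kernel s (x - y) \<partial>lborel) \<partial>Q)"
      using P.Fubini_integral[OF int] by simp
  qed
  show "integrable lborel (\<lambda>x. \<phi> x * riesz_potential s M N x)"
    unfolding riesz_potential_def right_diff_distrib using *(1)[OF M] *(1)[OF N] by simp
  show "(\<integral>x. \<phi> x * riesz_potential s M N x \<partial>lborel) =
      (\<integral>y. (\<integral>x. \<phi> x * riesz_kernel s (x - y) \<partial>lborel) \<partial>M)
      - (\<integral>y. (\<integral>x. \<phi> x * riesz_kernel s (x - y) \<partial>lborel) \<partial>N)"
    unfolding riesz_potential_def right_diff_distrib
    using *[OF M] *[OF N] by simp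
qed

end

theory Submission
  imports Defs
begin

text \<open>
  No Fourier transform is needed. With \<open>K\<close> the Riesz kernel of order \<open>(d + \<gamma>) / 2\<close>, the Gaussian
  subordination \<open>\<Gamma>(\<alpha>) r powr (- 2 \<alpha>) = \<integral> t powr (\<alpha> - 1) exp (- t r\<^sup>2) dt\<close> with \<open>\<alpha> = (d - \<gamma>) / 4\<close> turns
  \<open>\<integral> (K (x - y) - K (x - z))\<^sup>2 dx\<close> into a double integral of explicit Gaussian integrals. All integrands
  are nonnegative, so Tonelli applies, and the value is \<open>A * norm (y - z) powr \<gamma>\<close> with an explicit \<open>A\<close>.
  Polarization gives \<open>\<integral> (K (x - y) - K (x - z)) (K (x - y') - K (x - z')) dx\<close> as a combination of
  distances. Since the total mass of \<open>\<mu> - \<nu>\<close> is zero, its potential is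
  \<open>\<integral> (K (x - y) - K (x - z)) d\<mu>(y) d\<nu>(z)\<close>; squaring it and applying Fubini yields the energy distance.
\<close>

section \<open>Lebesgue measure on the positive half-line\<close>

text \<open>A density instead of a restricted space: the measurable space stays \<open>borel\<close>
  on \<open>UNIV\<close>, so measurability goals are those for \<open>lborel\<close>, while almost
  every point is positive.\<close>

definition lborel_pos :: "real measure" where
  "lborel_pos = density lborel (indicator {0<..})"

lemma sets_lborel_pos [measurable_cong, simp]: "sets lborel_pos = sets borel"
  by (simp add: lborel_pos_def)

lemma space_lborel_pos [simp]: "space lborel_pos = UNIV"
  by (simp add: lborel_pos_def)

interpretation lborel_pos: sigma_finite_measure lborel_pos
  unfolding lborel_pos_def
  by (subst sigma_finite_measure.sigma_finite_iff_density_finite[OF sigma_finite_lborel])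
    (auto simp: indicator_def)

lemma AE_lborel_pos: "AE t in lborel_pos. 0 < t"
  unfolding lborel_pos_def by (subst AE_density) (auto simp: indicator_def)

text \<open>The laws of \<open>powr\<close> used below need a positive base; this makes
  \<open>0 < t\<close> available when an integrand is rewritten.\<close>

lemma nn_integral_lborel_pos_cong:
  assumes "\<And>t. 0 < t \<Longrightarrow> f t = g t"
  shows "(\<integral>\<^sup>+t. f t \<partial>lborel_pos) = (\<integral>\<^sup>+t. g t \<partial>lborel_pos)"
  using AE_lborel_pos assms by (intro nn_integral_cong_AE) auto

lemma nn_integral_lborel_pos:
  assumes [measurable]: "f \<in> borel_measurable borel"
  shows "(\<integral>\<^sup>+t. f t \<partial>lborel_pos) = (\<integral>\<^sup>+t. indicator {0<..} t * f t \<partial>lborel)"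
  unfolding lborel_pos_def by (subst nn_integral_density) auto

lemma nn_integral_lborel_pos_scale:
  fixes c :: real
  assumes [measurable]: "f \<in> borel_measurable borel" and c: "0 < c"
  shows "(\<integral>\<^sup>+t. f t \<partial>lborel_pos) = ennreal c * (\<integral>\<^sup>+t. f (c * t) \<partial>lborel_pos)"
proof -
  have "(\<integral>\<^sup>+t. f t \<partial>lborel_pos) = ennreal \<bar>c\<bar> * (\<integral>\<^sup>+t. indicator {0<..} (0 + c * t) * f (0 + c * t) \<partial>lborel)"
    using c by (subst nn_integral_lborel_pos, simp, subst nn_integral_real_affine[where c = c and t = 0]) auto
  also have "\<dots> = ennreal c * (\<integral>\<^sup>+t. f (c * t) \<partial>lborel_pos)"
    using c by (subst nn_integral_lborel_pos) (auto simp: indicator_def zero_less_mult_iff)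
  finally show ?thesis .
qed

interpretation lborel_pos_pair: pair_sigma_finite lborel_pos lborel_pos ..

section \<open>Gamma and Beta integrals over the half-line\<close>

text \<open>Euler's integral for \<open>Gamma p\<close> after rescaling by \<open>c\<close>. With
  \<open>c\<close> a squared distance it is the Gaussian subordination formula.\<close>

lemma nn_integral_powr_exp:
  assumes p: "0 < p" and c: "0 < c"
  shows "(\<integral>\<^sup>+t. ennreal (t powr (p - 1) * exp (- (c * t))) \<partial>lborel_pos) = ennreal (Gamma p * c powr - p)"
proof -
  have "ennreal (Gamma p) = (\<integral>\<^sup>+t. ennreal (indicator {0..} t * t powr (p - 1) / exp t) \<partial>lborel)"
    by (rule Gamma_conv_nn_integral_real[OF p])
  \<comment> \<open>The two half-lines differ only at \<open>t = 0\<close>, where both integrands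
    vanish because \<open>0 powr (p - 1) = 0\<close>.\<close>
  also have "\<dots> = (\<integral>\<^sup>+t. indicator {0<..} t * ennreal (t powr (p - 1) * exp (- t)) \<partial>lborel)"
    by (intro nn_integral_cong) (auto simp: indicator_def exp_minus field_simps)
  also have "\<dots> = (\<integral>\<^sup>+t. ennreal (t powr (p - 1) * exp (- t)) \<partial>lborel_pos)"
    by (subst nn_integral_lborel_pos) auto
  also have "\<dots> = ennreal c * (\<integral>\<^sup>+t. ennreal ((c * t) powr (p - 1) * exp (- (c * t))) \<partial>lborel_pos)"
    using c by (subst nn_integral_lborel_pos_scale[where c = c]) auto
  also have "(\<integral>\<^sup>+t. ennreal ((c * t) powr (p - 1) * exp (- (c * t))) \<partial>lborel_pos)
      = (\<integral>\<^sup>+t. ennreal (c powr (p - 1)) * ennreal (t powr (p - 1) * exp (- (c * t))) \<partial>lborel_pos)"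
    using c by (intro nn_integral_lborel_pos_cong)
      (simp add: powr_mult ennreal_mult'[symmetric] mult.assoc)
  also have "\<dots> = ennreal (c powr (p - 1)) * (\<integral>\<^sup>+t. ennreal (t powr (p - 1) * exp (- (c * t))) \<partial>lborel_pos)"
    by (subst nn_integral_cmult) auto
  finally have *: "ennreal (Gamma p) = ennreal (c powr p) *
      (\<integral>\<^sup>+t. ennreal (t powr (p - 1) * exp (- (c * t))) \<partial>lborel_pos)" (is "_ = _ * ?J")
    using c by (simp add: mult.assoc[symmetric] ennreal_mult'[symmetric] powr_mult_base)
  \<comment> \<open>In \<open>ennreal\<close> the finite positive factor \<open>c powr p\<close> is
    removed by multiplying with its inverse \<open>c powr - p\<close>.\<close>
  have "ennreal (Gamma p * c powr - p) = ennreal (c powr - p) * (ennreal (c powr p) * ?J)"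
    using p c by (subst *[symmetric]) (simp add: ennreal_mult'[symmetric] mult.commute)
  also have "\<dots> = ?J"
    using c by (simp add: mult.assoc[symmetric] ennreal_mult'[symmetric] powr_add[symmetric])
  finally show ?thesis by simp
qed

text \<open>Formally a Gamma integral with negative parameter \<open>- h\<close>, made convergent by
  the subtraction from 1. Writing \<open>(1 - exp (- (b * t))) / t\<close> as the integral of
  \<open>exp (- (v * t))\<close> over \<open>v\<close> in \<open>{0..b}\<close> and exchanging the
  order leaves \<open>Gamma (1 - h) * v powr (h - 1)\<close>. The bound \<open>h < 1\<close> serves
  the Gamma integral, \<open>0 < h\<close> the integral over \<open>v\<close>.\<close>

lemma nn_integral_one_minus_exp:
  assumes h: "0 < h" "h < 1" and b: "0 \<le> b"
  shows "(\<integral>\<^sup>+t. ennreal (t powr (- h - 1) * (1 - exp (- (b * t)))) \<partial>lborel_pos)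
    = ennreal (Gamma (1 - h) * (b powr h / h))"
proof -
  \<comment> \<open>The exponent is left as \<open>(1 - h) - 1\<close> to match
    \<open>nn_integral_powr_exp\<close> with \<open>p = 1 - h\<close>.\<close>
  have inner: "ennreal (t powr (- h - 1) * (1 - exp (- (b * t))))
      = (\<integral>\<^sup>+v. ennreal (t powr ((1 - h) - 1) * exp (- (v * t))) * indicator {0..b} v \<partial>lborel_pos)"
    if t: "0 < t" for t
  proof -
    have "(\<integral>\<^sup>+v. ennreal (t powr ((1 - h) - 1) * exp (- (v * t))) * indicator {0..b} v \<partial>lborel_pos)
        = (\<integral>\<^sup>+v. indicator {0<..} v * (ennreal (t powr ((1 - h) - 1) * exp (- (v * t))) * indicator {0..b} v) \<partial>lborel)"
      by (subst nn_integral_lborel_pos) auto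
    also have "\<dots> = (\<integral>\<^sup>+v. ennreal (t powr ((1 - h) - 1) * exp (- (v * t))) * indicator {0..b} v \<partial>lborel)"
      by (intro nn_integral_cong_AE AE_I[where N="{0}"]) (auto simp: indicator_def)
    also have "\<dots> = ennreal (t powr (- h - 1) * - exp (- (b * t)) - t powr (- h - 1) * - exp (- (0 * t)))"
    proof (rule nn_integral_FTC_Icc)
      fix v assume "v \<in> {0..b}"
      have "t powr (- h) = t powr (- h - 1) * t"
        using t by (simp add: powr_mult_base mult.commute)
      then show "((\<lambda>v. t powr (- h - 1) * - exp (- (v * t))) has_real_derivative
          t powr ((1 - h) - 1) * exp (- (v * t))) (at v)"
        by (auto intro!: derivative_eq_intros)
    qed (use b in auto)
    finally show ?thesis by (simp add: algebra_simps)
  qed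
  have "(\<integral>\<^sup>+t. ennreal (t powr (- h - 1) * (1 - exp (- (b * t)))) \<partial>lborel_pos)
      = (\<integral>\<^sup>+t. (\<integral>\<^sup>+v. ennreal (t powr ((1 - h) - 1) * exp (- (v * t))) * indicator {0..b} v \<partial>lborel_pos) \<partial>lborel_pos)"
    by (intro nn_integral_lborel_pos_cong inner)
  also have "\<dots> = (\<integral>\<^sup>+v. (\<integral>\<^sup>+t. ennreal (t powr ((1 - h) - 1) * exp (- (v * t))) * indicator {0..b} v \<partial>lborel_pos) \<partial>lborel_pos)"
    by (rule lborel_pos_pair.Fubini') measurable
  also have "\<dots> = (\<integral>\<^sup>+v. ennreal (Gamma (1 - h)) * (ennreal (v powr (h - 1)) * indicator {0..b} v) \<partial>lborel_pos)"
  proof (rule nn_integral_lborel_pos_cong)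
    fix v :: real assume "0 < v"
    then show "(\<integral>\<^sup>+t. ennreal (t powr ((1 - h) - 1) * exp (- (v * t))) * indicator {0..b} v \<partial>lborel_pos)
       = ennreal (Gamma (1 - h)) * (ennreal (v powr (h - 1)) * indicator {0..b} v)"
      using h by (subst nn_integral_multc, measurable, subst nn_integral_powr_exp)
        (simp_all add: ennreal_mult' mult.assoc)
  qed
  also have "\<dots> = ennreal (Gamma (1 - h)) * (\<integral>\<^sup>+v. ennreal (v powr (h - 1)) * indicator {0..b} v \<partial>lborel_pos)"
    by (subst nn_integral_cmult) auto
  also have "(\<integral>\<^sup>+v. ennreal (v powr (h - 1)) * indicator {0..b} v \<partial>lborel_pos)
     = (\<integral>\<^sup>+v. indicator {0<..} v * (ennreal (v powr (h - 1)) * indicator {0..b} v) \<partial>lborel)"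
    by (subst nn_integral_lborel_pos) auto
  also have "\<dots> = (\<integral>\<^sup>+v. ennreal (v powr (h - 1)) * indicator {0..b} v \<partial>lborel)"
    by (intro nn_integral_cong_AE AE_I[where N="{0}"]) (auto simp: indicator_def)
  also have "\<dots> = ennreal (b powr (h - 1 + 1) / (h - 1 + 1))"
    using h b by (intro nn_integral_has_integral_lebesgue' has_integral_powr_from_0) auto
  also have "ennreal (Gamma (1 - h)) * ennreal (b powr (h - 1 + 1) / (h - 1 + 1)) = ennreal (Gamma (1 - h) * (b powr h / h))"
    using h by (simp add: ennreal_mult'[symmetric])
  finally show ?thesis .
qed

text \<open>
  The Beta integral in the variable \<open>x / (1 + x)\<close>, obtained by writing \<open>(1 + x) powr - (p + q)\<close> as a
  Gamma integral.
\<close>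

lemma nn_integral_beta_prime:
  assumes p: "0 < p" and q: "0 < q"
  shows "(\<integral>\<^sup>+x. ennreal (x powr (p - 1) * (1 + x) powr - (p + q)) \<partial>lborel_pos)
    = ennreal (Gamma p * Gamma q / Gamma (p + q))"
proof -
  have G: "Gamma (p + q) > 0" using p q by simp
  have "ennreal (Gamma (p + q)) * (\<integral>\<^sup>+x. ennreal (x powr (p - 1) * (1 + x) powr - (p + q)) \<partial>lborel_pos)
    = (\<integral>\<^sup>+x. ennreal (x powr (p - 1)) * ennreal (Gamma (p + q) * (1 + x) powr - (p + q)) \<partial>lborel_pos)"
    using G by (subst nn_integral_cmult[symmetric]) (auto simp: ennreal_mult' mult_ac)
  also have "\<dots> = (\<integral>\<^sup>+x. (\<integral>\<^sup>+t. ennreal (x powr (p - 1)) * ennreal (t powr (p + q - 1) * exp (- ((1 + x) * t))) \<partial>lborel_pos) \<partial>lborel_pos)"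
    using p q by (intro nn_integral_lborel_pos_cong, subst nn_integral_cmult)
      (simp_all add: nn_integral_powr_exp)
  also have "\<dots> = (\<integral>\<^sup>+t. (\<integral>\<^sup>+x. ennreal (x powr (p - 1)) * ennreal (t powr (p + q - 1) * exp (- ((1 + x) * t))) \<partial>lborel_pos) \<partial>lborel_pos)"
    by (rule lborel_pos_pair.Fubini') measurable
  \<comment> \<open>Splitting \<open>exp (- ((1 + x) * t))\<close> turns the integral over
    \<open>x\<close> into a Gamma integral with rate \<open>t\<close>; the form \<open>1 * t\<close>
    prepares the one over \<open>t\<close> with rate 1.\<close>
  also have "\<dots> = (\<integral>\<^sup>+t. (\<integral>\<^sup>+x. ennreal (t powr (p + q - 1) * exp (- (1 * t))) * ennreal (x powr (p - 1) * exp (- (t * x))) \<partial>lborel_pos) \<partial>lborel_pos)"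
    by (intro nn_integral_cong) (simp add: ennreal_mult'[symmetric] algebra_simps exp_add[symmetric])
  also have "\<dots> = (\<integral>\<^sup>+t. ennreal (t powr (p + q - 1) * exp (- (1 * t))) * ennreal (Gamma p * t powr - p) \<partial>lborel_pos)"
    using p by (intro nn_integral_lborel_pos_cong, subst nn_integral_cmult)
      (simp_all add: nn_integral_powr_exp)
  also have "\<dots> = (\<integral>\<^sup>+t. ennreal (Gamma p) * ennreal (t powr (q - 1) * exp (- (1 * t))) \<partial>lborel_pos)"
  proof (rule nn_integral_lborel_pos_cong)
    fix t :: real assume t: "0 < t"
    have "t powr (p + q - 1) * t powr - p = t powr (q - 1)"
      using t by (simp add: powr_add[symmetric])
    then have "t powr (p + q - 1) * exp (- (1 * t)) * (Gamma p * t powr - p)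
        = Gamma p * (t powr (q - 1) * exp (- (1 * t)))" by (metis mult.assoc mult.commute)
    then show "ennreal (t powr (p + q - 1) * exp (- (1 * t))) * ennreal (Gamma p * t powr - p)
        = ennreal (Gamma p) * ennreal (t powr (q - 1) * exp (- (1 * t)))"
      using p by (simp add: ennreal_mult'[symmetric] del: mult_1)
  qed
  also have "\<dots> = ennreal (Gamma p * Gamma q)"
    using p q nn_integral_powr_exp[OF q, of 1] by (subst nn_integral_cmult) (simp_all add: ennreal_mult')
  finally have *: "ennreal (Gamma (p + q)) * (\<integral>\<^sup>+x. ennreal (x powr (p - 1) * (1 + x) powr - (p + q)) \<partial>lborel_pos)
    = ennreal (Gamma p * Gamma q)" (is "_ * ?J = _") .
  have "ennreal (Gamma p * Gamma q / Gamma (p + q)) = ennreal (inverse (Gamma (p + q))) * (ennreal (Gamma (p + q)) * ?J)"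
    using G p q by (subst *) (simp add: ennreal_mult'[symmetric] field_simps)
  also have "\<dots> = ?J" using G
    by (simp add: mult.assoc[symmetric] ennreal_mult'[symmetric])
  finally show ?thesis by simp
qed

text \<open>
  The substitution \<open>u = t q\<close> separates the variables: the integral over \<open>t\<close> is
  \<open>nn_integral_one_minus_exp\<close>, the remaining one over \<open>q\<close> is a Beta integral.
\<close>

lemma nn_integral_scale_mixture:
  fixes \<alpha> h R :: real
  assumes \<alpha>: "0 < \<alpha>" and h: "0 < h" "h < 1" and R: "0 \<le> R"
  shows "(\<integral>\<^sup>+t. (\<integral>\<^sup>+u. ennreal (t powr (\<alpha> - 1) * u powr (\<alpha> - 1) * (t + u) powr - (2 * \<alpha> + h)
      * (1 - exp (- (t * u / (t + u) * R)))) \<partial>lborel_pos) \<partial>lborel_pos)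
    = ennreal (Gamma (1 - h) / h * R powr h * (Gamma (\<alpha> + h))\<^sup>2 / Gamma (2 * \<alpha> + 2 * h))"
proof -
  define w where "w q = q powr (\<alpha> - 1) * (1 + q) powr - (2 * \<alpha> + h)" for q :: real
  have [measurable]: "w \<in> borel_measurable borel"
    unfolding w_def by measurable
  have "(\<integral>\<^sup>+t. (\<integral>\<^sup>+u. ennreal (t powr (\<alpha> - 1) * u powr (\<alpha> - 1) * (t + u) powr - (2 * \<alpha> + h)
      * (1 - exp (- (t * u / (t + u) * R)))) \<partial>lborel_pos) \<partial>lborel_pos)
    = (\<integral>\<^sup>+t. (\<integral>\<^sup>+q. ennreal (w q * (t powr (- h - 1) * (1 - exp (- (q / (1 + q) * R * t))))) \<partial>lborel_pos) \<partial>lborel_pos)"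
  proof (rule nn_integral_lborel_pos_cong)
    fix t :: real assume t: "0 < t"
    \<comment> \<open>The leading \<open>t\<close> is the Jacobian of \<open>u = t * q\<close>. The
      powers of \<open>t\<close> add up to
      \<open>1 + 2 * (\<alpha> - 1) - (2 * \<alpha> + h) = - h - 1\<close>.\<close>
    have pt: "t * (t powr (\<alpha> - 1) * (t * q) powr (\<alpha> - 1) * (t + t * q) powr - (2 * \<alpha> + h)
        * (1 - exp (- (t * (t * q) / (t + t * q) * R))))
      = w q * (t powr (- h - 1) * (1 - exp (- (q / (1 + q) * R * t))))" if q: "0 < q" for q
    proof -
      have e: "t * (t * q) / (t + t * q) * R = q / (1 + q) * R * t"
      proof -
        have "t * (t * q) / (t + t * q) = t * (t * q) / (t * (1 + q))"
          by (simp add: algebra_simps)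
        then show ?thesis using t by simp
      qed
      have "(t + t * q) powr - (2 * \<alpha> + h) = (t * (1 + q)) powr - (2 * \<alpha> + h)"
        by (simp add: algebra_simps)
      also have "\<dots> = t powr - (2 * \<alpha> + h) * (1 + q) powr - (2 * \<alpha> + h)"
        using t q by (subst powr_mult) auto
      finally have 1: "(t + t * q) powr - (2 * \<alpha> + h) = \<dots>" .
      have "t * (t powr (\<alpha> - 1) * t powr (\<alpha> - 1) * t powr - (2 * \<alpha> + h))
          = t powr 1 * t powr (\<alpha> - 1) * t powr (\<alpha> - 1) * t powr - (2 * \<alpha> + h)"
        using t by simp
      also have "\<dots> = t powr (- h - 1)"
        unfolding powr_add[symmetric] by (rule arg_cong[where f = "(powr) t"]) simp
      finally have 2: "t powr (- h - 1) = t * (t powr (\<alpha> - 1) * t powr (\<alpha> - 1) * t powr - (2 * \<alpha> + h))" ..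
      show ?thesis
        unfolding e 1 2 w_def using t q by (simp add: powr_mult del: minus_add_distrib)
    qed
    have "(\<integral>\<^sup>+u. ennreal (t powr (\<alpha> - 1) * u powr (\<alpha> - 1) * (t + u) powr - (2 * \<alpha> + h)
      * (1 - exp (- (t * u / (t + u) * R)))) \<partial>lborel_pos)
      = (\<integral>\<^sup>+q. ennreal (t * (t powr (\<alpha> - 1) * (t * q) powr (\<alpha> - 1) * (t + t * q) powr - (2 * \<alpha> + h)
        * (1 - exp (- (t * (t * q) / (t + t * q) * R))))) \<partial>lborel_pos)"
      using t by (subst nn_integral_lborel_pos_scale[where c = t], measurable, simp, subst nn_integral_cmult[symmetric])
        (simp_all add: ennreal_mult')
    also have "\<dots> = (\<integral>\<^sup>+q. ennreal (w q * (t powr (- h - 1) * (1 - exp (- (q / (1 + q) * R * t))))) \<partial>lborel_pos)"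
      by (intro nn_integral_lborel_pos_cong) (subst pt, simp_all)
    finally show "(\<integral>\<^sup>+u. ennreal (t powr (\<alpha> - 1) * u powr (\<alpha> - 1) * (t + u) powr - (2 * \<alpha> + h)
      * (1 - exp (- (t * u / (t + u) * R)))) \<partial>lborel_pos)
      = (\<integral>\<^sup>+q. ennreal (w q * (t powr (- h - 1) * (1 - exp (- (q / (1 + q) * R * t))))) \<partial>lborel_pos)" .
  qed
  also have "\<dots> = (\<integral>\<^sup>+q. (\<integral>\<^sup>+t. ennreal (w q * (t powr (- h - 1) * (1 - exp (- (q / (1 + q) * R * t))))) \<partial>lborel_pos) \<partial>lborel_pos)"
    by (rule lborel_pos_pair.Fubini') measurable
  \<comment> \<open>The integral over \<open>t\<close> contributes
    \<open>(q / (1 + q) * R) powr h\<close>, which shifts both exponents of \<open>w\<close>; what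
    remains is the Beta integral with both parameters equal to \<open>\<alpha> + h\<close>.\<close>
  also have "\<dots> = (\<integral>\<^sup>+q. ennreal (Gamma (1 - h) / h * R powr h)
      * ennreal (q powr ((\<alpha> + h) - 1) * (1 + q) powr - ((\<alpha> + h) + (\<alpha> + h))) \<partial>lborel_pos)"
  proof (rule nn_integral_lborel_pos_cong)
    fix q :: real assume q: "0 < q"
    have w0: "0 \<le> w q" by (simp add: w_def)
    have "(\<integral>\<^sup>+t. ennreal (w q * (t powr (- h - 1) * (1 - exp (- (q / (1 + q) * R * t))))) \<partial>lborel_pos)
        = ennreal (w q) * ennreal (Gamma (1 - h) * ((q / (1 + q) * R) powr h / h))"
    proof -
      have "0 \<le> q / (1 + q) * R" using q R by simp
      from nn_integral_one_minus_exp[OF h this] show ?thesis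
        unfolding ennreal_mult'[OF w0] by (subst nn_integral_cmult) auto
    qed
    also have "\<dots> = ennreal (w q * (Gamma (1 - h) * ((q / (1 + q) * R) powr h / h)))"
      by (rule ennreal_mult'[OF w0, symmetric])
    also have "(q / (1 + q) * R) powr h = q powr h * (1 + q) powr - h * R powr h"
      using q R by (simp add: powr_mult powr_divide powr_minus_divide)
    also have "w q * (Gamma (1 - h) * (q powr h * (1 + q) powr - h * R powr h / h))
       = Gamma (1 - h) / h * R powr h * ((q powr (\<alpha> - 1) * q powr h) * ((1 + q) powr - (2 * \<alpha> + h) * (1 + q) powr - h))"
      by (simp add: w_def mult_ac)
    also have "q powr (\<alpha> - 1) * q powr h = q powr ((\<alpha> + h) - 1)"
      by (simp add: powr_add[symmetric] algebra_simps)
    also have "(1 + q) powr - (2 * \<alpha> + h) * (1 + q) powr - h = (1 + q) powr - ((\<alpha> + h) + (\<alpha> + h))"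
      unfolding powr_add[symmetric] by (rule arg_cong[where f = "(powr) (1 + q)"]) simp
    finally show "(\<integral>\<^sup>+t. ennreal (w q * (t powr (- h - 1) * (1 - exp (- (q / (1 + q) * R * t))))) \<partial>lborel_pos)
       = ennreal (Gamma (1 - h) / h * R powr h)
      * ennreal (q powr ((\<alpha> + h) - 1) * (1 + q) powr - ((\<alpha> + h) + (\<alpha> + h)))"
      by (simp only: ennreal_mult'' mult_nonneg_nonneg powr_ge_zero)
  qed
  also have "\<dots> = ennreal (Gamma (1 - h) / h * R powr h)
      * ennreal (Gamma (\<alpha> + h) * Gamma (\<alpha> + h) / Gamma ((\<alpha> + h) + (\<alpha> + h)))"
    using \<alpha> h by (subst nn_integral_cmult, measurable, subst nn_integral_beta_prime) simp_all
  also have "\<dots> = ennreal (Gamma (1 - h) / h * R powr h * (Gamma (\<alpha> + h))\<^sup>2 / Gamma (2 * \<alpha> + 2 * h))"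
    using h \<alpha> by (subst ennreal_mult'[symmetric]) (simp_all add: power2_eq_square algebra_simps)
  finally show ?thesis .
qed

section \<open>Gaussian integrals on Euclidean space\<close>

lemma nn_integral_gaussian_real:
  assumes s: "0 < s"
  shows "(\<integral>\<^sup>+x. ennreal (exp (- (s * (x::real)\<^sup>2))) \<partial>lborel) = ennreal (sqrt (pi / s))"
proof -
  \<comment> \<open>The standard deviation for which \<open>normal_density 0 \<sigma>\<close> has
    the exponent \<open>- (s * x\<^sup>2)\<close>.\<close>
  define \<sigma> where "\<sigma> = sqrt (1 / (2 * s))"
  have \<sigma>: "0 < \<sigma>" "\<sigma>\<^sup>2 = 1 / (2 * s)" using s by (simp_all add: \<sigma>_def)
  have e: "exp (- (s * x\<^sup>2)) = sqrt (pi / s) * normal_density 0 \<sigma> x" for x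
    using s by (simp add: normal_density_def \<sigma>(2) real_sqrt_divide)
  have "(\<integral>\<^sup>+x. ennreal (normal_density 0 \<sigma> x) \<partial>lborel) = 1"
    using \<sigma> by (subst nn_integral_eq_integral) auto
  then show ?thesis
    using s unfolding e by (simp add: ennreal_mult' nn_integral_cmult)
qed

text \<open>Translation invariance moves the centre to 0; the integrand is then a product of
  one-dimensional Gaussians over the coordinates.\<close>

lemma nn_integral_gaussian:
  assumes s: "0 < s"
  shows "(\<integral>\<^sup>+x. ennreal (exp (- (s * (norm (x - c :: 'a::euclidean_space))\<^sup>2))) \<partial>lborel)
    = ennreal ((pi / s) powr (real DIM('a) / 2))"
proof -
  have "(\<integral>\<^sup>+x. ennreal (exp (- (s * (norm (x - c))\<^sup>2))) \<partial>lborel)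
    = (\<integral>\<^sup>+x. ennreal (exp (- (s * (norm x)\<^sup>2))) \<partial>distr lborel borel ((+) (- c)))"
    by (subst nn_integral_distr) auto
  also have "\<dots> = (\<integral>\<^sup>+x. ennreal (exp (- (s * (norm (x::'a))\<^sup>2))) \<partial>lborel)"
    by (simp add: lborel_distr_plus)
  also have "\<dots> = (\<integral>\<^sup>+x. (\<Prod>b\<in>Basis. ennreal (exp (- (s * ((x::'a) \<bullet> b)\<^sup>2)))) \<partial>lborel)"
  proof (rule nn_integral_cong)
    fix x :: 'a
    have "(norm x)\<^sup>2 = (\<Sum>b\<in>Basis. (x \<bullet> b)\<^sup>2)"
      unfolding power2_norm_eq_inner by (subst euclidean_inner) (simp add: power2_eq_square)
    then show "ennreal (exp (- (s * (norm x)\<^sup>2))) = (\<Prod>b\<in>Basis. ennreal (exp (- (s * (x \<bullet> b)\<^sup>2))))"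
      by (simp add: prod_ennreal exp_sum[symmetric] sum_distrib_left sum_negf)
  qed
  also have "\<dots> = (\<Prod>b\<in>(Basis::'a set). (\<integral>\<^sup>+x. ennreal (exp (- (s * x\<^sup>2))) \<partial>lborel))"
    by (rule nn_integral_lborel_prod) auto
  also have "\<dots> = ennreal (sqrt (pi / s) ^ DIM('a))"
    using s by (simp add: nn_integral_gaussian_real ennreal_power)
  also have "sqrt (pi / s) ^ DIM('a) = (pi / s) powr (real DIM('a) / 2)"
    using s by (simp add: powr_half_sqrt[symmetric] powr_realpow[symmetric] powr_powr)
  finally show ?thesis .
qed

text \<open>Completing the square: the weighted squared distances split into a part about the centre
  of mass and a part free of \<open>x\<close>. Hence a product of two Gaussians is again a Gaussian
  in \<open>x\<close>, up to a constant factor.\<close>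

lemma weighted_parallelogram:
  fixes x y z :: "'a::real_inner"
  assumes "t + u \<noteq> 0"
  shows "t * (norm (x - y))\<^sup>2 + u * (norm (x - z))\<^sup>2
    = (t + u) * (norm (x - (t / (t + u)) *\<^sub>R y - (u / (t + u)) *\<^sub>R z))\<^sup>2 + t * u / (t + u) * (norm (y - z))\<^sup>2"
proof -
  define p where "p = t / (t + u)"
  define q where "q = u / (t + u)"
  have pq: "(t + u) * p = t" "(t + u) * q = u" "t * u / (t + u) = (t + u) * p * q"
    using assms by (simp_all add: p_def q_def)
  have "p + q = 1" using assms by (simp add: p_def q_def add_divide_distrib[symmetric])
  then have q: "q = 1 - p" by simp
  have "t * (norm (x - y))\<^sup>2 + u * (norm (x - z))\<^sup>2
      = (t + u) * (p * (norm (x - y))\<^sup>2 + q * (norm (x - z))\<^sup>2)"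
    using pq by (metis distrib_left mult.assoc)
  also have "p * (norm (x - y))\<^sup>2 + q * (norm (x - z))\<^sup>2
     = (norm (x - p *\<^sub>R y - q *\<^sub>R z))\<^sup>2 + p * q * (norm (y - z))\<^sup>2"
    unfolding power2_norm_eq_inner q
    by (simp add: inner_diff_left inner_diff_right inner_commute algebra_simps power2_eq_square)
  finally have "t * (norm (x - y))\<^sup>2 + u * (norm (x - z))\<^sup>2
     = (t + u) * (norm (x - p *\<^sub>R y - q *\<^sub>R z))\<^sup>2 + (t + u) * p * q * (norm (y - z))\<^sup>2"
    by (simp only: distrib_left mult.assoc)
  then show ?thesis
    unfolding pq(3)[symmetric] unfolding p_def q_def .
qed

text \<open>Apply \<open>weighted_parallelogram\<close> in the exponent, then integrate a single
  Gaussian. The Bochner form allows such integrals to be subtracted from one another.\<close>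

lemma has_bochner_integral_gaussian_prod:
  fixes y z :: "'a::euclidean_space"
  assumes t: "0 < t" and u: "0 < u"
  shows "has_bochner_integral lborel (\<lambda>x. exp (- (t * (norm (x - y))\<^sup>2)) * exp (- (u * (norm (x - z))\<^sup>2)))
    ((pi / (t + u)) powr (real DIM('a) / 2) * exp (- (t * u / (t + u) * (norm (y - z))\<^sup>2)))"
proof (rule has_bochner_integral_nn_integral)
  define c where "c = (t / (t + u)) *\<^sub>R y + (u / (t + u)) *\<^sub>R z"
  have "exp (- (t * (norm (x - y))\<^sup>2)) * exp (- (u * (norm (x - z))\<^sup>2))
     = exp (- ((t + u) * (norm (x - c))\<^sup>2)) * exp (- (t * u / (t + u) * (norm (y - z))\<^sup>2))" for x
    using weighted_parallelogram[of t u x y z] t u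
    by (simp add: exp_add[symmetric] c_def diff_diff_eq)
  then show "(\<integral>\<^sup>+x. ennreal (exp (- (t * (norm (x - y))\<^sup>2)) * exp (- (u * (norm (x - z))\<^sup>2))) \<partial>lborel)
    = ennreal ((pi / (t + u)) powr (real DIM('a) / 2) * exp (- (t * u / (t + u) * (norm (y - z))\<^sup>2)))"
    using t u by (simp add: ennreal_mult' nn_integral_multc nn_integral_gaussian)
qed auto

text \<open>The absolute values keep the integrand nonnegative for Tonelli and cost nothing: for all
  positive \<open>t\<close> and \<open>u\<close> both differences have the same sign, decided by
  which of \<open>y\<close> and \<open>z\<close> is nearer to \<open>x\<close>. Expanding gives four
  Gaussian products; the two with a single centre yield the 1, the two mixed ones the
  exponential.\<close>

lemma nn_integral_gaussian_diff_prod: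
  fixes y z :: "'a::euclidean_space"
  assumes t: "0 < t" and u: "0 < u"
  shows "(\<integral>\<^sup>+x. ennreal (\<bar>exp (- (t * (norm (x - y))\<^sup>2)) - exp (- (t * (norm (x - z))\<^sup>2))\<bar>
        * \<bar>exp (- (u * (norm (x - y))\<^sup>2)) - exp (- (u * (norm (x - z))\<^sup>2))\<bar>) \<partial>lborel)
    = ennreal (2 * (pi / (t + u)) powr (real DIM('a) / 2) * (1 - exp (- (t * u / (t + u) * (norm (y - z))\<^sup>2))))"
proof -
  let ?e = "\<lambda>t y x. exp (- (t * (norm (x - y))\<^sup>2))"
  note b = has_bochner_integral_gaussian_prod[OF t u]
  have same_sign: "\<bar>?e t y x - ?e t z x\<bar> * \<bar>?e u y x - ?e u z x\<bar> = (?e t y x - ?e t z x) * (?e u y x - ?e u z x)" for x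
  proof (cases "(norm (x - y))\<^sup>2 \<le> (norm (x - z))\<^sup>2")
    case True
    then have "?e t z x \<le> ?e t y x" "?e u z x \<le> ?e u y x" using t u by simp_all
    then show ?thesis by simp
  next
    case False
    then have "?e t y x \<le> ?e t z x" "?e u y x \<le> ?e u z x" using t u by simp_all
    then show ?thesis by (simp add: abs_of_nonpos algebra_simps)
  qed
  have "has_bochner_integral lborel (\<lambda>x. (?e t y x * ?e u y x - ?e t y x * ?e u z x) - (?e t z x * ?e u y x - ?e t z x * ?e u z x))
    (((pi / (t + u)) powr (real DIM('a) / 2) * exp (- (t * u / (t + u) * (norm (y - y))\<^sup>2))
      - (pi / (t + u)) powr (real DIM('a) / 2) * exp (- (t * u / (t + u) * (norm (y - z))\<^sup>2)))
    - ((pi / (t + u)) powr (real DIM('a) / 2) * exp (- (t * u / (t + u) * (norm (z - y))\<^sup>2))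
      - (pi / (t + u)) powr (real DIM('a) / 2) * exp (- (t * u / (t + u) * (norm (z - z))\<^sup>2))))"
    by (intro has_bochner_integral_diff b)
  then have "has_bochner_integral lborel (\<lambda>x. \<bar>?e t y x - ?e t z x\<bar> * \<bar>?e u y x - ?e u z x\<bar>)
    (2 * (pi / (t + u)) powr (real DIM('a) / 2) * (1 - exp (- (t * u / (t + u) * (norm (y - z))\<^sup>2))))"
    unfolding same_sign by (simp add: algebra_simps norm_minus_commute)
  then show ?thesis
    by (subst nn_integral_eq_integral) (auto simp: has_bochner_integral_iff)
qed

section \<open>Differences of power kernels and of Riesz kernels\<close>

text \<open>Subordination with rates \<open>m\<^sup>2\<close> and \<open>n\<^sup>2\<close>: the
  difference of the exponentials keeps its sign for all \<open>t > 0\<close>, so the absolute value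
  passes through the integral.\<close>

lemma nn_integral_powr_exp_diff:
  fixes m n :: real
  assumes \<alpha>: "0 < \<alpha>" and "0 < m" "0 < n"
  shows "(\<integral>\<^sup>+t. ennreal (t powr (\<alpha> - 1) * \<bar>exp (- (t * m\<^sup>2)) - exp (- (t * n\<^sup>2))\<bar>) \<partial>lborel_pos)
    = ennreal (Gamma \<alpha> * \<bar>m powr - (2 * \<alpha>) - n powr - (2 * \<alpha>)\<bar>)"
proof -
  have b: "has_bochner_integral lborel_pos (\<lambda>t. t powr (\<alpha> - 1) * exp (- (t * k\<^sup>2))) (Gamma \<alpha> * k powr - (2 * \<alpha>))"
    if k: "0 < k" for k
  proof (rule has_bochner_integral_nn_integral)
    have "(k\<^sup>2) powr - \<alpha> = k powr - (2 * \<alpha>)"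
      using k powr_powr[of k 2 "- \<alpha>"] by simp
    then show "(\<integral>\<^sup>+t. ennreal (t powr (\<alpha> - 1) * exp (- (t * k\<^sup>2))) \<partial>lborel_pos) = ennreal (Gamma \<alpha> * k powr - (2 * \<alpha>))"
      using nn_integral_powr_exp[OF \<alpha>, of "k\<^sup>2"] k by (simp only: mult.commute[of "k\<^sup>2"] zero_less_power)
    show "0 \<le> Gamma \<alpha> * k powr - (2 * \<alpha>)" using \<alpha> by simp
  qed auto
  have *: "(\<integral>\<^sup>+t. ennreal (t powr (\<alpha> - 1) * \<bar>exp (- (t * m\<^sup>2)) - exp (- (t * n\<^sup>2))\<bar>) \<partial>lborel_pos)
    = ennreal (Gamma \<alpha> * \<bar>m powr - (2 * \<alpha>) - n powr - (2 * \<alpha>)\<bar>)"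
    if mn: "0 < m" "m \<le> n" for m n
  proof -
    have exp_mono: "exp (- (t * n\<^sup>2)) \<le> exp (- (t * m\<^sup>2))" if "0 < t" for t
      using power_mono[of m n 2] that mn by simp
    have "n powr - (2 * \<alpha>) \<le> m powr - (2 * \<alpha>)"
      using powr_mono2'[of "- (2 * \<alpha>)" m n] mn \<alpha> by simp
    then have G: "Gamma \<alpha> * \<bar>m powr - (2 * \<alpha>) - n powr - (2 * \<alpha>)\<bar>
        = Gamma \<alpha> * m powr - (2 * \<alpha>) - Gamma \<alpha> * n powr - (2 * \<alpha>)"
      by (simp add: right_diff_distrib)
    have diff: "has_bochner_integral lborel_pos
        (\<lambda>t. t powr (\<alpha> - 1) * exp (- (t * m\<^sup>2)) - t powr (\<alpha> - 1) * exp (- (t * n\<^sup>2)))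
        (Gamma \<alpha> * m powr - (2 * \<alpha>) - Gamma \<alpha> * n powr - (2 * \<alpha>))"
      using mn by (intro has_bochner_integral_diff b) auto
    have "AE t in lborel_pos. 0 \<le> t powr (\<alpha> - 1) * exp (- (t * m\<^sup>2)) - t powr (\<alpha> - 1) * exp (- (t * n\<^sup>2))"
      using AE_lborel_pos by eventually_elim (simp add: exp_mono mult_left_mono del: exp_le_cancel_iff)
    with diff have "(\<integral>\<^sup>+t. ennreal (t powr (\<alpha> - 1) * exp (- (t * m\<^sup>2)) - t powr (\<alpha> - 1) * exp (- (t * n\<^sup>2))) \<partial>lborel_pos)
       = ennreal (Gamma \<alpha> * m powr - (2 * \<alpha>) - Gamma \<alpha> * n powr - (2 * \<alpha>))"
      using nn_integral_eq_integral[of lborel_pos "\<lambda>t. t powr (\<alpha> - 1) * exp (- (t * m\<^sup>2)) - t powr (\<alpha> - 1) * exp (- (t * n\<^sup>2))"]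
      unfolding has_bochner_integral_iff by simp
    moreover have "(\<integral>\<^sup>+t. ennreal (t powr (\<alpha> - 1) * \<bar>exp (- (t * m\<^sup>2)) - exp (- (t * n\<^sup>2))\<bar>) \<partial>lborel_pos)
       = (\<integral>\<^sup>+t. ennreal (t powr (\<alpha> - 1) * exp (- (t * m\<^sup>2)) - t powr (\<alpha> - 1) * exp (- (t * n\<^sup>2))) \<partial>lborel_pos)"
      by (intro nn_integral_lborel_pos_cong)
        (simp only: exp_mono abs_of_nonneg diff_ge_0_iff_ge right_diff_distrib)
    ultimately show ?thesis unfolding G by simp
  qed
  show ?thesis
  proof (cases "m \<le> n")
    case True
    then show ?thesis using *[of m n] assms by simp
  next
    case False
    then show ?thesis using *[of n m] assms
      by (simp only: abs_minus_commute[of "exp (- (t * m\<^sup>2))" for t] abs_minus_commute[of "m powr p" for p])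
  qed
qed

text \<open>The square of a subordination integral is a double integral over \<open>t\<close> and
  \<open>u\<close>. With \<open>x\<close> integrated first,
  \<open>nn_integral_gaussian_diff_prod\<close> applies, and
  \<open>nn_integral_scale_mixture\<close> finishes with \<open>R = (norm (y - z))\<^sup>2\<close>.
  The relation between \<open>DIM('a)\<close>, \<open>\<alpha>\<close> and \<open>h\<close> gives
  the Gaussian factor the power of \<open>t + u\<close> required there.\<close>

lemma nn_integral_norm_powr_diff_sq:
  fixes y z :: "'a::euclidean_space"
  assumes \<alpha>: "0 < \<alpha>" and h: "0 < h" "h < 1" and d: "real DIM('a) / 2 = 2 * \<alpha> + h"
  shows "(\<integral>\<^sup>+x. ennreal ((norm (x - y) powr - (2 * \<alpha>) - norm (x - z) powr - (2 * \<alpha>))\<^sup>2) \<partial>lborel)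
    = ennreal (2 * pi powr (real DIM('a) / 2) * Gamma (1 - h) * (Gamma (\<alpha> + h))\<^sup>2
        / (h * Gamma (2 * \<alpha> + 2 * h) * (Gamma \<alpha>)\<^sup>2) * norm (y - z) powr (2 * h))"
proof -
  define D where "D = real DIM('a) / 2"
  define e where "e t x = \<bar>exp (- (t * (norm (x - y))\<^sup>2)) - exp (- (t * (norm (x - z))\<^sup>2))\<bar>" for t and x :: 'a
  define k where "k t x = t powr (\<alpha> - 1) * e t x" for t and x :: 'a
  have e0: "0 \<le> e t x" for t x by (simp add: e_def)
  have k0: "0 \<le> k t x" for t x by (simp add: k_def e0)
  have [measurable]: "(\<lambda>p. e (fst p) (snd p)) \<in> borel_measurable (borel \<Otimes>\<^sub>M borel)"
    unfolding e_def by measurable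
  have [measurable]: "(\<lambda>p. k (fst p) (snd p)) \<in> borel_measurable (borel \<Otimes>\<^sub>M borel)"
    unfolding k_def by measurable
  \<comment> \<open>Joint measurability of \<open>k\<close> for arbitrary argument functions, as the
    nested integrals below require.\<close>
  have km [measurable (raw)]: "(\<lambda>w. k (f w) (g w)) \<in> borel_measurable L"
    if "f \<in> borel_measurable L" "g \<in> borel_measurable L" for f :: "'b \<Rightarrow> real" and g and L :: "'b measure"
    using measurable_compose[OF measurable_Pair[OF that] \<open>(\<lambda>p. k (fst p) (snd p)) \<in> _\<close>] by simp
  interpret X: pair_sigma_finite lborel lborel_pos ..
  let ?diff = "\<lambda>x. norm (x - y) powr - (2 * \<alpha>) - norm (x - z) powr - (2 * \<alpha>)"
  \<comment> \<open>The identity fails at the excluded points when \<open>y \<noteq> z\<close>: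
    there the left side is finite by the convention that \<open>0 powr _\<close> is 0, while the
    right side diverges. Two points form a null set.\<close>
  have sq: "ennreal ((Gamma \<alpha>)\<^sup>2 * (?diff x)\<^sup>2)
      = (\<integral>\<^sup>+t. (\<integral>\<^sup>+u. ennreal (k t x * k u x) \<partial>lborel_pos) \<partial>lborel_pos)"
    if x: "x \<noteq> y" "x \<noteq> z" for x
  proof -
    have I: "(\<integral>\<^sup>+t. ennreal (k t x) \<partial>lborel_pos) = ennreal (Gamma \<alpha> * \<bar>?diff x\<bar>)"
      unfolding k_def e_def using x by (intro nn_integral_powr_exp_diff \<alpha>) auto
    have "(\<integral>\<^sup>+t. (\<integral>\<^sup>+u. ennreal (k t x * k u x) \<partial>lborel_pos) \<partial>lborel_pos)
       = (\<integral>\<^sup>+t. ennreal (k t x) * (\<integral>\<^sup>+u. ennreal (k u x) \<partial>lborel_pos) \<partial>lborel_pos)"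
      by (subst nn_integral_cmult[symmetric]) (auto simp: ennreal_mult' k0)
    also have "\<dots> = ennreal (Gamma \<alpha> * \<bar>?diff x\<bar>) * ennreal (Gamma \<alpha> * \<bar>?diff x\<bar>)"
      by (subst nn_integral_multc) (simp_all add: I)
    also have "\<dots> = ennreal ((Gamma \<alpha>)\<^sup>2 * (?diff x)\<^sup>2)"
      using \<alpha> by (subst ennreal_mult'[symmetric]) (simp_all add: power2_eq_square algebra_simps)
    finally show ?thesis by simp
  qed
  have "ennreal ((Gamma \<alpha>)\<^sup>2) * (\<integral>\<^sup>+x. ennreal ((?diff x)\<^sup>2) \<partial>lborel)
      = (\<integral>\<^sup>+x. ennreal ((Gamma \<alpha>)\<^sup>2 * (?diff x)\<^sup>2) \<partial>lborel)"
    by (subst nn_integral_cmult[symmetric]) (auto simp: ennreal_mult')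
  also have "\<dots> = (\<integral>\<^sup>+x. (\<integral>\<^sup>+t. (\<integral>\<^sup>+u. ennreal (k t x * k u x) \<partial>lborel_pos) \<partial>lborel_pos) \<partial>lborel)"
  proof (rule nn_integral_cong_AE)
    show "AE x in lborel. ennreal ((Gamma \<alpha>)\<^sup>2 * (?diff x)\<^sup>2)
      = (\<integral>\<^sup>+t. (\<integral>\<^sup>+u. ennreal (k t x * k u x) \<partial>lborel_pos) \<partial>lborel_pos)"
      using AE_lborel_singleton[of y] AE_lborel_singleton[of z] by eventually_elim (rule sq)
  qed
  \<comment> \<open>Two exchanges bring the integral over \<open>x\<close> to the innermost
    place.\<close>
  also have "\<dots> = (\<integral>\<^sup>+t. (\<integral>\<^sup>+x. (\<integral>\<^sup>+u. ennreal (k t x * k u x) \<partial>lborel_pos) \<partial>lborel) \<partial>lborel_pos)"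
    by (rule X.Fubini'[symmetric]) measurable
  also have "\<dots> = (\<integral>\<^sup>+t. (\<integral>\<^sup>+u. (\<integral>\<^sup>+x. ennreal (k t x * k u x) \<partial>lborel) \<partial>lborel_pos) \<partial>lborel_pos)"
    by (intro nn_integral_cong X.Fubini'[symmetric]) measurable
  also have "\<dots> = (\<integral>\<^sup>+t. (\<integral>\<^sup>+u. ennreal (2 * pi powr D) * ennreal (t powr (\<alpha> - 1) * u powr (\<alpha> - 1) * (t + u) powr - (2 * \<alpha> + h)
      * (1 - exp (- (t * u / (t + u) * (norm (y - z))\<^sup>2)))) \<partial>lborel_pos) \<partial>lborel_pos)"
  proof (intro nn_integral_lborel_pos_cong)
    fix t u :: real assume t: "0 < t" and u: "0 < u"
    have "(\<integral>\<^sup>+x. ennreal (k t x * k u x) \<partial>lborel)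
       = (\<integral>\<^sup>+x. ennreal (t powr (\<alpha> - 1) * u powr (\<alpha> - 1)) * ennreal (e t x * e u x) \<partial>lborel)"
      by (intro nn_integral_cong, subst ennreal_mult'[symmetric]) (simp_all add: k_def mult_ac)
    also have "\<dots> = ennreal (t powr (\<alpha> - 1) * u powr (\<alpha> - 1)) * (\<integral>\<^sup>+x. ennreal (e t x * e u x) \<partial>lborel)"
      unfolding e_def by (rule nn_integral_cmult) measurable
    also have "(\<integral>\<^sup>+x. ennreal (e t x * e u x) \<partial>lborel)
       = ennreal (2 * (pi / (t + u)) powr D * (1 - exp (- (t * u / (t + u) * (norm (y - z))\<^sup>2))))"
      unfolding e_def D_def using t u by (rule nn_integral_gaussian_diff_prod)
    also have "(pi / (t + u)) powr D = pi powr D * (t + u) powr - (2 * \<alpha> + h)"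
      using t u d by (simp only: D_def powr_divide powr_minus_divide) (simp add: divide_simps powr_divide)
    finally show "(\<integral>\<^sup>+x. ennreal (k t x * k u x) \<partial>lborel)
       = ennreal (2 * pi powr D) * ennreal (t powr (\<alpha> - 1) * u powr (\<alpha> - 1) * (t + u) powr - (2 * \<alpha> + h)
      * (1 - exp (- (t * u / (t + u) * (norm (y - z))\<^sup>2))))"
      by (simp only: ennreal_mult'[symmetric] mult_nonneg_nonneg powr_ge_zero zero_le_numeral) (simp add: mult_ac)
  qed
  also have "\<dots> = ennreal (2 * pi powr D) * ennreal (Gamma (1 - h) / h * ((norm (y - z))\<^sup>2) powr h * (Gamma (\<alpha> + h))\<^sup>2 / Gamma (2 * \<alpha> + 2 * h))"
    using nn_integral_scale_mixture[OF \<alpha> h, of "(norm (y - z))\<^sup>2"]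
    by (simp add: nn_integral_cmult)
  also have "((norm (y - z))\<^sup>2) powr h = norm (y - z) powr (2 * h)"
    using powr_powr[of "norm (y - z)" 2 h] by simp
  finally have *: "ennreal ((Gamma \<alpha>)\<^sup>2) * (\<integral>\<^sup>+x. ennreal ((?diff x)\<^sup>2) \<partial>lborel)
     = ennreal (2 * pi powr D * (Gamma (1 - h) / h * norm (y - z) powr (2 * h) * (Gamma (\<alpha> + h))\<^sup>2 / Gamma (2 * \<alpha> + 2 * h)))"
    (is "_ * ?J = ennreal ?V")
    by (subst ennreal_mult') simp_all
  have G: "Gamma \<alpha> > 0" using \<alpha> by simp
  then have "?J = ennreal (inverse ((Gamma \<alpha>)\<^sup>2)) * (ennreal ((Gamma \<alpha>)\<^sup>2) * ?J)"
    by (simp add: mult.assoc[symmetric] ennreal_mult'[symmetric])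
  also have "\<dots> = ennreal (inverse ((Gamma \<alpha>)\<^sup>2) * ?V)"
    unfolding * by (rule ennreal_mult'[symmetric]) simp
  also have "inverse ((Gamma \<alpha>)\<^sup>2) * ?V = 2 * pi powr (real DIM('a) / 2) * Gamma (1 - h) * (Gamma (\<alpha> + h))\<^sup>2
        / (h * Gamma (2 * \<alpha> + 2 * h) * (Gamma \<alpha>)\<^sup>2) * norm (y - z) powr (2 * h)"
    using G by (simp add: D_def field_simps)
  finally show ?thesis .
qed

text \<open>With \<open>\<alpha> = (d - \<gamma>) / 4\<close> and \<open>h = \<gamma> / 2\<close>
  the kernel of order \<open>(d + \<gamma>) / 2\<close> has exponent
  \<open>- (2 * \<alpha>)\<close>, and \<open>d / 2 = 2 * \<alpha> + h\<close>. The rest is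
  bookkeeping of constants.\<close>

lemma integral_riesz_kernel_diff_sq:
  fixes y z :: "'a::euclidean_space" and \<gamma> :: real
  assumes \<gamma>: "0 < \<gamma>" "\<gamma> < 2" "\<gamma> < real DIM('a)"
  shows "has_bochner_integral lborel
    (\<lambda>x. (riesz_kernel ((real DIM('a) + \<gamma>) / 2) (x - y) - riesz_kernel ((real DIM('a) + \<gamma>) / 2) (x - z))\<^sup>2)
    (2 / ((2 * pi) powr real DIM('a) * F_const \<gamma> DIM('a)) * norm (y - z) powr \<gamma>)"
proof (rule has_bochner_integral_nn_integral)
  define d where "d = real DIM('a)"
  define \<alpha> where "\<alpha> = (d - \<gamma>) / 4"
  define C where "C = inverse (riesz_const DIM('a) ((d + \<gamma>) / 2))"
  \<comment> \<open>\<open>G1\<close> and \<open>G2\<close> also make up the Gamma quotient of the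
    Riesz constant and cancel; \<open>G3\<close> and \<open>G4\<close> are the Gamma values in
    \<open>F_const\<close>.\<close>
  define G1 where "G1 = Gamma \<alpha>"
  define G2 where "G2 = Gamma (\<alpha> + \<gamma> / 2)"
  define G3 where "G3 = Gamma (1 - \<gamma> / 2)"
  define G4 where "G4 = Gamma (2 * \<alpha> + \<gamma>)"
  have \<alpha>: "0 < \<alpha>" using \<gamma> by (simp add: \<alpha>_def d_def)
  have pos: "G1 > 0" "G2 > 0" "G3 > 0" "G4 > 0"
    using \<alpha> \<gamma> by (simp_all add: G1_def G2_def G3_def G4_def)
  have K: "riesz_kernel ((d + \<gamma>) / 2) x = C * norm x powr - (2 * \<alpha>)" for x :: 'a
  proof -
    have "(d + \<gamma>) / 2 - d = - (2 * \<alpha>)" by (simp add: \<alpha>_def field_simps)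
    then show ?thesis unfolding riesz_kernel_def C_def d_def[symmetric] by simp
  qed
  have C: "C = G1 / (pi powr (d / 2) * 2 powr ((d + \<gamma>) / 2) * G2)"
  proof -
    have e: "(d + \<gamma>) / 2 / 2 = \<alpha> + \<gamma> / 2" "(d - (d + \<gamma>) / 2) / 2 = \<alpha>"
      by (simp_all add: \<alpha>_def field_simps)
    show ?thesis
      unfolding C_def riesz_const_def d_def[symmetric] e G1_def G2_def by simp
  qed
  have F: "F_const \<gamma> DIM('a) = \<gamma> * 2 powr (\<gamma> - 1) * G4 / (pi powr (d / 2) * G3)"
  proof -
    have e: "(d + \<gamma>) / 2 = 2 * \<alpha> + \<gamma>" by (simp add: \<alpha>_def field_simps)
    show ?thesis
      unfolding F_const_def d_def[symmetric] e G3_def G4_def by simp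
  qed
  have "(2 powr ((d + \<gamma>) / 2))\<^sup>2 = 2 powr (d + \<gamma>)" "(pi powr (d / 2))\<^sup>2 = pi powr d"
    by (simp_all add: power2_eq_square powr_add[symmetric])
  moreover have "2 powr (d + \<gamma>) = 2 * (2 powr d * 2 powr (\<gamma> - 1))"
    by (simp add: powr_add powr_diff)
  moreover have "(2 * pi) powr d = 2 powr d * pi powr d"
    by (simp add: powr_mult)
  ultimately have const: "C\<^sup>2 * (2 * pi powr (d / 2) * G3 * G2\<^sup>2 / (\<gamma> / 2 * G4 * G1\<^sup>2))
      = 2 / ((2 * pi) powr d * F_const \<gamma> DIM('a))"
    unfolding C F using pos \<gamma>(1) by (simp add: power_divide power_mult_distrib field_simps)
  let ?n = "\<lambda>x. norm (x - y) powr - (2 * \<alpha>) - norm (x - z) powr - (2 * \<alpha>)"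
  have "(\<integral>\<^sup>+x. ennreal ((C * norm (x - y) powr - (2 * \<alpha>) - C * norm (x - z) powr - (2 * \<alpha>))\<^sup>2) \<partial>lborel)
      = (\<integral>\<^sup>+x. ennreal (C\<^sup>2) * ennreal ((?n x)\<^sup>2) \<partial>lborel)"
    by (intro nn_integral_cong, subst ennreal_mult'[symmetric])
      (simp_all add: right_diff_distrib[symmetric] power_mult_distrib)
  also have "\<dots> = ennreal (C\<^sup>2) * (\<integral>\<^sup>+x. ennreal ((?n x)\<^sup>2) \<partial>lborel)"
    by (rule nn_integral_cmult) measurable
  also have "(\<integral>\<^sup>+x. ennreal ((?n x)\<^sup>2) \<partial>lborel)
      = ennreal (2 * pi powr (real DIM('a) / 2) * Gamma (1 - \<gamma> / 2) * (Gamma (\<alpha> + \<gamma> / 2))\<^sup>2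
        / (\<gamma> / 2 * Gamma (2 * \<alpha> + 2 * (\<gamma> / 2)) * (Gamma \<alpha>)\<^sup>2) * norm (y - z) powr (2 * (\<gamma> / 2)))"
    using \<gamma> \<alpha> by (intro nn_integral_norm_powr_diff_sq) (simp_all add: \<alpha>_def d_def field_simps)
  also have "\<dots> = ennreal (2 * pi powr (d / 2) * G3 * G2\<^sup>2 / (\<gamma> / 2 * G4 * G1\<^sup>2) * norm (y - z) powr \<gamma>)"
    by (simp add: G1_def G2_def G3_def G4_def d_def)
  also have "ennreal (C\<^sup>2) * \<dots> = ennreal (C\<^sup>2 * (2 * pi powr (d / 2) * G3 * G2\<^sup>2 / (\<gamma> / 2 * G4 * G1\<^sup>2)) * norm (y - z) powr \<gamma>)"
    by (subst ennreal_mult'[symmetric]) (simp_all add: mult_ac)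
  finally show "(\<integral>\<^sup>+x. ennreal ((riesz_kernel ((real DIM('a) + \<gamma>) / 2) (x - y) - riesz_kernel ((real DIM('a) + \<gamma>) / 2) (x - z))\<^sup>2) \<partial>lborel)
    = ennreal (2 / ((2 * pi) powr real DIM('a) * F_const \<gamma> DIM('a)) * norm (y - z) powr \<gamma>)"
    unfolding const d_def[symmetric] K .
  have "F_const \<gamma> DIM('a) \<ge> 0" unfolding F using pos \<gamma>(1) by simp
  then show "0 \<le> 2 / ((2 * pi) powr real DIM('a) * F_const \<gamma> DIM('a)) * norm (y - z) powr \<gamma>"
    by simp
qed auto

text \<open>Only squares of differences occur on the right. This matters because the kernel of order
  \<open>(d + \<gamma>) / 2\<close> is not itself square-integrable, decaying too slowly at
  infinity.\<close>

lemma polarization_identity: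
  fixes a b a' b' :: real
  shows "(a - b) * (a' - b') = ((a - b')\<^sup>2 + (a' - b)\<^sup>2 - (a - a')\<^sup>2 - (b - b')\<^sup>2) / 2"
  by (simp add: power2_eq_square algebra_simps)

text \<open>Each square in \<open>polarization_identity\<close> is a difference of two translates,
  so \<open>integral_riesz_kernel_diff_sq\<close> evaluates it; the halving cancels the 2 in its
  constant.\<close>

lemma integral_riesz_kernel_diff_prod:
  fixes y z y' z' :: "'a::euclidean_space" and \<gamma> :: real
  assumes \<gamma>: "0 < \<gamma>" "\<gamma> < 2" "\<gamma> < real DIM('a)"
  defines "k \<equiv> riesz_kernel ((real DIM('a) + \<gamma>) / 2)"
  shows "has_bochner_integral lborel (\<lambda>x. (k (x - y) - k (x - z)) * (k (x - y') - k (x - z')))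
    ((norm (y - z') powr \<gamma> + norm (y' - z) powr \<gamma> - norm (y - y') powr \<gamma> - norm (z - z') powr \<gamma>)
      / ((2 * pi) powr real DIM('a) * F_const \<gamma> DIM('a)))"
proof -
  let ?A = "2 / ((2 * pi) powr real DIM('a) * F_const \<gamma> DIM('a))"
  note sq = integral_riesz_kernel_diff_sq[OF \<gamma>, folded k_def]
  have "has_bochner_integral lborel (\<lambda>x. ((k (x - y) - k (x - z'))\<^sup>2 + (k (x - y') - k (x - z))\<^sup>2
      - (k (x - y) - k (x - y'))\<^sup>2 - (k (x - z) - k (x - z'))\<^sup>2) / 2)
    ((?A * norm (y - z') powr \<gamma> + ?A * norm (y' - z) powr \<gamma> - ?A * norm (y - y') powr \<gamma> - ?A * norm (z - z') powr \<gamma>) / 2)"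
    by (intro has_bochner_integral_divide_zero has_bochner_integral_diff has_bochner_integral_add sq)
  then show ?thesis
    unfolding polarization_identity
    by (simp add: diff_divide_distrib add_divide_distrib)
qed

section \<open>Marginals of product measures\<close>

lemma (in prob_space) distr_pair_snd:
  assumes "sigma_finite_measure N"
  shows "distr (M \<Otimes>\<^sub>M N) N snd = N"
proof -
  interpret N: sigma_finite_measure N by fact
  interpret P: pair_sigma_finite M N ..
  have "distr (M \<Otimes>\<^sub>M N) N snd = distr (distr (N \<Otimes>\<^sub>M M) (M \<Otimes>\<^sub>M N) (\<lambda>(x, y). (y, x))) N snd"
    by (subst P.distr_pair_swap) simp
  also have "\<dots> = distr (N \<Otimes>\<^sub>M M) N fst"
    by (subst distr_distr) (auto simp: comp_def case_prod_beta intro!: distr_cong)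
  finally show ?thesis by (simp add: distr_pair_fst)
qed

text \<open>The equation \<open>distr M A f = A\<close> says that \<open>f\<close> has law
  \<open>A\<close> under \<open>M\<close>; the rest is change of variables.\<close>

lemma has_bochner_integral_marginal:
  fixes F :: "'a \<Rightarrow> real"
  assumes "integrable A F" and f: "f \<in> measurable M A" and A: "distr M A f = A"
  shows "has_bochner_integral M (\<lambda>p. F (f p)) (integral\<^sup>L A F)"
proof -
  have [measurable]: "F \<in> borel_measurable A" using assms(1) by simp
  have "integrable M (\<lambda>p. F (f p))"
    using assms(1) A integrable_distr_eq[OF f, of F] by simp
  moreover have "(\<integral>p. F (f p) \<partial>M) = integral\<^sup>L A F"
    using integral_distr[OF f, of F] A by simp
  ultimately show ?thesis by (simp add: has_bochner_integral_iff)
qed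

text \<open>Functions of independent coordinates are independent, so their joint law is the product
  of their laws.\<close>

lemma distr_pair_marginals:
  assumes "f \<in> measurable M A" "g \<in> measurable N B" "distr M A f = A" "distr N B g = B"
    and "sigma_finite_measure B"
  shows "distr (M \<Otimes>\<^sub>M N) (A \<Otimes>\<^sub>M B) (\<lambda>p. (f (fst p), g (snd p))) = A \<Otimes>\<^sub>M B"
  using pair_measure_distr[OF assms(1,2)] assms(3-5) by (simp add: case_prod_beta')

section \<open>Mean distances and the energy distance\<close>

text \<open>Compact support enters here: it bounds the integrand almost everywhere by a constant,
  which is integrable for a probability measure.\<close>

lemma integrable_norm_diff_powr:
  fixes M N :: "'a::euclidean_space measure"
  assumes M: "prob_space M" "sets M = sets borel" "compactly_supported M"
    and N: "prob_space N" "sets N = sets borel" "compactly_supported N"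
    and \<gamma>: "0 \<le> \<gamma>"
  shows "integrable (M \<Otimes>\<^sub>M N) (\<lambda>p. norm (fst p - snd p) powr \<gamma>)"
proof -
  interpret M: prob_space M by fact
  interpret N: prob_space N by fact
  note [measurable_cong] = M(2) N(2)
  have AE_bounded: "\<exists>R. AE x in Q. norm x \<le> R" if "compactly_supported Q" for Q :: "'a measure"
  proof -
    obtain K where K: "compact K" "AE x in Q. x \<in> K"
      using \<open>compactly_supported Q\<close> by (auto simp: compactly_supported_def)
    obtain R where "\<And>x. x \<in> K \<Longrightarrow> norm x \<le> R"
      using compact_imp_bounded[OF K(1)] by (auto simp: bounded_iff)
    then have "AE x in Q. norm x \<le> R" using K(2) by (auto elim: eventually_mono)
    then show ?thesis ..
  qed
  obtain R S where R: "AE x in M. norm x \<le> R" and S: "AE x in N. norm x \<le> S"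
    using AE_bounded[OF M(3)] AE_bounded[OF N(3)] by blast
  have "(\<integral>\<^sup>+p. ennreal (norm (norm (fst p - snd p) powr \<gamma>)) \<partial>(M \<Otimes>\<^sub>M N))
     = (\<integral>\<^sup>+x. (\<integral>\<^sup>+y. ennreal (norm (x - y) powr \<gamma>) \<partial>N) \<partial>M)"
    by (subst N.nn_integral_fst[symmetric]) simp_all
  also have "\<dots> \<le> (\<integral>\<^sup>+x. (\<integral>\<^sup>+y. ennreal ((R + S) powr \<gamma>) \<partial>N) \<partial>M)"
  proof (intro nn_integral_mono_AE)
    show "AE x in M. (\<integral>\<^sup>+y. ennreal (norm (x - y) powr \<gamma>) \<partial>N) \<le> (\<integral>\<^sup>+y. ennreal ((R + S) powr \<gamma>) \<partial>N)"
      using R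
    proof eventually_elim
      case (elim x)
      have "AE y in N. ennreal (norm (x - y) powr \<gamma>) \<le> ennreal ((R + S) powr \<gamma>)"
        using S
      proof eventually_elim
        case (elim y)
        have "norm (x - y) \<le> R + S"
          using norm_triangle_ineq4[of x y] \<open>norm x \<le> R\<close> elim by linarith
        then show ?case
          using \<gamma> by (intro ennreal_leI powr_mono2) auto
      qed
      then show ?case by (rule nn_integral_mono_AE)
    qed
  qed
  also have "\<dots> < \<infinity>"
    by (simp add: M.emeasure_space_1 N.emeasure_space_1)
  finally show ?thesis
    by (intro integrableI_bounded) auto
qed

text \<open>Written with projections, so that composing with a pair-valued map, as in
  \<open>has_bochner_integral_marginal\<close>, simplifies directly.\<close>

definition mean_distance :: "real \<Rightarrow> 'a::euclidean_space measure \<Rightarrow> 'a measure \<Rightarrow> real" where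
  "mean_distance \<gamma> M N = (\<integral>p. norm (fst p - snd p) powr \<gamma> \<partial>(M \<Otimes>\<^sub>M N))"

lemma mean_distance_commute:
  fixes M N :: "'a::euclidean_space measure"
  assumes "sigma_finite_measure M" "sets M = sets borel" "sigma_finite_measure N" "sets N = sets borel"
  shows "mean_distance \<gamma> M N = mean_distance \<gamma> N M"
proof -
  interpret M: sigma_finite_measure M by fact
  interpret N: sigma_finite_measure N by fact
  interpret P: pair_sigma_finite M N ..
  note [measurable_cong] = assms(2,4)
  show ?thesis
    unfolding mean_distance_def
    by (subst P.integral_product_swap[symmetric]) (simp_all add: case_prod_beta' norm_minus_commute)
qed

text \<open>Each of the three terms depends on two of the four coordinates only, and the joint law
  of those two is the product of their marginals.\<close>

lemma energy_distance_eq: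
  fixes M N :: "'a::euclidean_space measure"
  assumes M: "prob_space M" "sets M = sets borel" "compactly_supported M"
    and N: "prob_space N" "sets N = sets borel" "compactly_supported N"
    and \<gamma>: "0 \<le> \<gamma>"
  shows "energy_distance \<gamma> M N
    = sqrt (2 * mean_distance \<gamma> M N - mean_distance \<gamma> M M - mean_distance \<gamma> N N)"
proof -
  interpret M: prob_space M by fact
  interpret N: prob_space N by fact
  interpret MM: pair_prob_space M M ..
  interpret NN: pair_prob_space N N ..
  note [measurable_cong] = M(2) N(2)
  note i = integrable_norm_diff_powr[OF _ _ _ _ _ _ \<gamma>]
  have 1: "has_bochner_integral ((M \<Otimes>\<^sub>M M) \<Otimes>\<^sub>M (N \<Otimes>\<^sub>M N)) (\<lambda>p. norm (fst (fst p) - fst (snd p)) powr \<gamma>) (mean_distance \<gamma> M N)"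
  proof -
    have "(\<lambda>p. (fst (fst p), fst (snd p))) \<in> measurable ((M \<Otimes>\<^sub>M M) \<Otimes>\<^sub>M (N \<Otimes>\<^sub>M N)) (M \<Otimes>\<^sub>M N)"
      by measurable
    from has_bochner_integral_marginal[OF i[OF M N] this distr_pair_marginals[OF measurable_fst measurable_fst
        M.distr_pair_fst N.distr_pair_fst N.sigma_finite_measure_axioms]]
    show ?thesis by (simp add: mean_distance_def)
  qed
  have 2: "has_bochner_integral ((M \<Otimes>\<^sub>M M) \<Otimes>\<^sub>M (N \<Otimes>\<^sub>M N)) (\<lambda>p. norm (fst (fst p) - snd (fst p)) powr \<gamma>) (mean_distance \<gamma> M M)"
    unfolding mean_distance_def
    by (rule has_bochner_integral_marginal[OF i[OF M M] measurable_fst NN.distr_pair_fst])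
  have 3: "has_bochner_integral ((M \<Otimes>\<^sub>M M) \<Otimes>\<^sub>M (N \<Otimes>\<^sub>M N)) (\<lambda>p. norm (fst (snd p) - snd (snd p)) powr \<gamma>) (mean_distance \<gamma> N N)"
    unfolding mean_distance_def
    by (rule has_bochner_integral_marginal[OF i[OF N N] measurable_snd
        MM.distr_pair_snd[OF NN.sigma_finite_measure_axioms]])
  have "has_bochner_integral ((M \<Otimes>\<^sub>M M) \<Otimes>\<^sub>M (N \<Otimes>\<^sub>M N))
      (\<lambda>p. 2 * norm (fst (fst p) - fst (snd p)) powr \<gamma> - norm (fst (fst p) - snd (fst p)) powr \<gamma> - norm (fst (snd p) - snd (snd p)) powr \<gamma>)
      (2 * mean_distance \<gamma> M N - mean_distance \<gamma> M M - mean_distance \<gamma> N N)"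
    by (intro has_bochner_integral_diff has_bochner_integral_mult_right 1 2 3)
  then show ?thesis
    unfolding energy_distance_def by (simp add: has_bochner_integral_iff case_prod_beta')
qed

section \<open>The squared norm of the potential\<close>

text \<open>The integral of \<open>g x p * g x p'\<close> over \<open>x\<close>, \<open>p\<close>
  and \<open>p'\<close> is evaluated in both orders. Integrating over \<open>x\<close> first gives
  distances, hence mean distances; integrating over \<open>p\<close> and \<open>p'\<close> first
  gives the square of the potential.\<close>

lemma riesz_potential_sq_integral:
  fixes M N :: "'a::euclidean_space measure"
  assumes \<gamma>: "0 < \<gamma>" "\<gamma> < 2" "\<gamma> < real DIM('a)"
    and M: "prob_space M" "sets M = sets borel" "compactly_supported M"
    and N: "prob_space N" "sets N = sets borel" "compactly_supported N"
  shows "has_bochner_integral lborel (\<lambda>x. (riesz_potential ((real DIM('a) + \<gamma>) / 2) M N x)\<^sup>2)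
    ((2 * mean_distance \<gamma> M N - mean_distance \<gamma> M M - mean_distance \<gamma> N N)
      / ((2 * pi) powr real DIM('a) * F_const \<gamma> DIM('a)))"
proof -
  interpret M: prob_space M by fact
  interpret N: prob_space N by fact
  interpret P: pair_prob_space M N ..
  interpret PP: pair_prob_space "M \<Otimes>\<^sub>M N" "M \<Otimes>\<^sub>M N" ..
  interpret X: pair_sigma_finite lborel "(M \<Otimes>\<^sub>M N) \<Otimes>\<^sub>M (M \<Otimes>\<^sub>M N)" ..
  note [measurable_cong] = M(2) N(2)
  define s where "s = (real DIM('a) + \<gamma>) / 2"
  have s: "0 < s" "s < real DIM('a)" using \<gamma> by (simp_all add: s_def)
  define c where "c = (2 * pi) powr real DIM('a) * F_const \<gamma> DIM('a)"
  \<comment> \<open>Both measures have mass one, so \<open>g x\<close> integrates over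
    \<open>M \<Otimes>\<^sub>M N\<close> to the potential at \<open>x\<close> whenever the kernel
    integrals converge.\<close>
  define g where "g x p = riesz_kernel s (x - fst p) - riesz_kernel s (x - snd p)" for x :: 'a and p
  note i = integrable_norm_diff_powr[OF _ _ _ _ _ _ less_imp_le[OF \<gamma>(1)]]
  let ?PP = "(M \<Otimes>\<^sub>M N) \<Otimes>\<^sub>M (M \<Otimes>\<^sub>M N)"
  have sets_P: "sets (M \<Otimes>\<^sub>M N) = sets (borel \<Otimes>\<^sub>M borel)"
    using M(2) N(2) by (rule sets_pair_measure_cong)
  note [measurable_cong] = sets_P
  have [measurable]: "g x \<in> borel_measurable (borel \<Otimes>\<^sub>M borel)" "(\<lambda>x. g x p) \<in> borel_measurable borel" for x p
    unfolding g_def by measurable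
  have [measurable]: "(\<lambda>w. g (fst w) (fst (snd w))) \<in> borel_measurable (lborel \<Otimes>\<^sub>M ?PP)"
    "(\<lambda>w. g (fst w) (snd (snd w))) \<in> borel_measurable (lborel \<Otimes>\<^sub>M ?PP)"
    unfolding g_def by measurable

  have prod: "has_bochner_integral lborel (\<lambda>x. g x (fst q) * g x (snd q))
    ((norm (fst (fst q) - snd (snd q)) powr \<gamma> + norm (fst (snd q) - snd (fst q)) powr \<gamma>
      - norm (fst (fst q) - fst (snd q)) powr \<gamma> - norm (snd (fst q) - snd (snd q)) powr \<gamma>) / c)" for q
    unfolding g_def c_def s_def by (rule integral_riesz_kernel_diff_prod[OF \<gamma>])
  have sq: "has_bochner_integral lborel (\<lambda>x. (g x p)\<^sup>2) (2 / c * norm (fst p - snd p) powr \<gamma>)" for p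
    unfolding g_def c_def s_def by (rule integral_riesz_kernel_diff_sq[OF \<gamma>])

  have marg: "has_bochner_integral ?PP (\<lambda>q. norm (f (fst q) - h (snd q)) powr \<gamma>) (mean_distance \<gamma> A B)"
    if "prob_space A" "sets A = sets borel" "compactly_supported A" "prob_space B" "sets B = sets borel" "compactly_supported B"
      and f: "f \<in> measurable (M \<Otimes>\<^sub>M N) A" "distr (M \<Otimes>\<^sub>M N) A f = A"
      and h: "h \<in> measurable (M \<Otimes>\<^sub>M N) B" "distr (M \<Otimes>\<^sub>M N) B h = B" for A B f h
  proof -
    interpret B: prob_space B by fact
    have "(\<lambda>q. (f (fst q), h (snd q))) \<in> measurable ?PP (A \<Otimes>\<^sub>M B)"
      using f(1) h(1) by measurable
    from has_bochner_integral_marginal[OF i[OF that(1-6)] this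
        distr_pair_marginals[OF f(1) h(1) f(2) h(2) B.sigma_finite_measure_axioms]]
    show ?thesis by (simp add: mean_distance_def)
  qed
  note fst = measurable_fst[of M N] N.distr_pair_fst[of M]
  note snd = measurable_snd[of M N] M.distr_pair_snd[OF N.sigma_finite_measure_axioms]
  have total: "has_bochner_integral ?PP (\<lambda>q. (norm (fst (fst q) - snd (snd q)) powr \<gamma> + norm (fst (snd q) - snd (fst q)) powr \<gamma>
      - norm (fst (fst q) - fst (snd q)) powr \<gamma> - norm (snd (fst q) - snd (snd q)) powr \<gamma>) / c)
    ((mean_distance \<gamma> M N + mean_distance \<gamma> N M - mean_distance \<gamma> M M - mean_distance \<gamma> N N) / c)"
    \<comment> \<open>For \<open>q = ((y, z), (y', z'))\<close> the pairs \<open>(y, z')\<close>,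
      \<open>(z, y')\<close>, \<open>(y, y')\<close> and \<open>(z, z')\<close> have the laws
      \<open>M \<Otimes>\<^sub>M N\<close>, \<open>N \<Otimes>\<^sub>M M\<close>,
      \<open>M \<Otimes>\<^sub>M M\<close> and \<open>N \<Otimes>\<^sub>M N\<close>.\<close>
    using marg[OF M N fst snd] marg[OF N M snd fst] marg[OF M M fst fst] marg[OF N N snd snd]
    by (intro has_bochner_integral_divide_zero has_bochner_integral_diff has_bochner_integral_add)
      (simp_all add: norm_minus_commute)

  \<comment> \<open>Fubini needs absolute integrability. The product is bounded by the sum of the
    two squares; integrated over \<open>x\<close>, each gives \<open>b\<close>, a multiple of
    \<open>norm (y - z) powr \<gamma>\<close>, which is integrable over
    \<open>M \<Otimes>\<^sub>M N\<close>.\<close>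
  have int: "integrable (lborel \<Otimes>\<^sub>M ?PP) (\<lambda>(x, q). g x (fst q) * g x (snd q))"
  proof (rule integrableI_bounded)
    define b where "b p = 2 / c * norm (fst p - snd p) powr \<gamma>" for p :: "'a \<times> 'a"
    have b0: "0 \<le> b p" for p
      unfolding b_def has_bochner_integral_integral_eq[OF sq[of p], symmetric] by simp
    have bm [measurable]: "b \<in> borel_measurable (borel \<Otimes>\<^sub>M borel)"
      unfolding b_def by measurable
    have sq': "(\<integral>\<^sup>+x. ennreal ((g x p)\<^sup>2) \<partial>lborel) = ennreal (b p)" for p
      using sq[of p] unfolding b_def by (simp add: nn_integral_eq_integral has_bochner_integral_iff)
    have bfin: "(\<integral>\<^sup>+p. ennreal (b p) \<partial>(M \<Otimes>\<^sub>M N)) < \<infinity>"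
    proof -
      have "integrable (M \<Otimes>\<^sub>M N) b"
        unfolding b_def using i[OF M N] by (rule integrable_mult_right)
      then have "(\<integral>\<^sup>+p. ennreal (norm (b p)) \<partial>(M \<Otimes>\<^sub>M N)) < \<infinity>"
        unfolding integrable_iff_bounded by blast
      then show ?thesis using b0 by simp
    qed
    have "(\<lambda>w. ennreal \<bar>g (fst w) (fst (snd w)) * g (fst w) (snd (snd w))\<bar>)
        \<in> borel_measurable (lborel \<Otimes>\<^sub>M ?PP)"
      by measurable
    from X.nn_integral_snd[OF this]
    have "(\<integral>\<^sup>+w. ennreal (norm (case w of (x, q) \<Rightarrow> g x (fst q) * g x (snd q))) \<partial>(lborel \<Otimes>\<^sub>M ?PP))
        = (\<integral>\<^sup>+q. (\<integral>\<^sup>+x. ennreal \<bar>g x (fst q) * g x (snd q)\<bar> \<partial>lborel) \<partial>?PP)"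
      by (simp add: case_prod_beta')
    also have "\<dots> \<le> (\<integral>\<^sup>+q. (\<integral>\<^sup>+x. ennreal ((g x (fst q))\<^sup>2) + ennreal ((g x (snd q))\<^sup>2) \<partial>lborel) \<partial>?PP)"
    proof (intro nn_integral_mono)
      fix q x
      have "\<bar>g x (fst q) * g x (snd q)\<bar> \<le> (g x (fst q))\<^sup>2 + (g x (snd q))\<^sup>2"
        using sum_squares_bound[of "\<bar>g x (fst q)\<bar>" "\<bar>g x (snd q)\<bar>"]
          abs_ge_zero[of "g x (fst q) * g x (snd q)"]
        unfolding power2_abs mult.assoc abs_mult[symmetric] by linarith
      then show "ennreal \<bar>g x (fst q) * g x (snd q)\<bar> \<le> ennreal ((g x (fst q))\<^sup>2) + ennreal ((g x (snd q))\<^sup>2)"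
        by (simp only: ennreal_plus[symmetric] zero_le_power2 ennreal_leI)
    qed
    also have "\<dots> = (\<integral>\<^sup>+q. ennreal (b (fst q)) + ennreal (b (snd q)) \<partial>?PP)"
      by (subst nn_integral_add) (simp_all add: sq')
    also have "\<dots> = (\<integral>\<^sup>+q. ennreal (b (fst q)) \<partial>?PP) + (\<integral>\<^sup>+q. ennreal (b (snd q)) \<partial>?PP)"
      by (subst nn_integral_add) simp_all
    also have "(\<integral>\<^sup>+q. ennreal (b (fst q)) \<partial>?PP) = (\<integral>\<^sup>+p. ennreal (b p) \<partial>(M \<Otimes>\<^sub>M N))"
      by (subst P.distr_pair_fst[symmetric], subst nn_integral_distr) simp_all
    also have "(\<integral>\<^sup>+q. ennreal (b (snd q)) \<partial>?PP) = (\<integral>\<^sup>+p. ennreal (b p) \<partial>(M \<Otimes>\<^sub>M N))"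
      by (subst P.distr_pair_snd[OF P.sigma_finite_measure_axioms, symmetric], subst nn_integral_distr) simp_all
    also have "(\<integral>\<^sup>+p. ennreal (b p) \<partial>(M \<Otimes>\<^sub>M N)) + (\<integral>\<^sup>+p. ennreal (b p) \<partial>(M \<Otimes>\<^sub>M N)) < \<infinity>"
      using bfin by simp
    finally show "(\<integral>\<^sup>+w. ennreal (norm (case w of (x, q) \<Rightarrow> g x (fst q) * g x (snd q))) \<partial>(lborel \<Otimes>\<^sub>M ?PP)) < \<infinity>" .
  qed (simp add: case_prod_beta')

  \<comment> \<open>Valid where both kernel integrals and the section of the product converge, hence
    almost everywhere. There the integral over \<open>(p, p')\<close> factors into the square of the
    integral of \<open>g x\<close>.\<close>
  have pot: "AE x in lborel. (\<integral>q. g x (fst q) * g x (snd q) \<partial>?PP) = (riesz_potential s M N x)\<^sup>2"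
    using X.AE_integrable_fst[OF int] AE_integrable_riesz_kernel[OF s M.finite_measure_axioms M(2)]
      AE_integrable_riesz_kernel[OF s N.finite_measure_axioms N(2)]
  proof eventually_elim
    case (elim x)
    have "has_bochner_integral (M \<Otimes>\<^sub>M N) (g x) (riesz_potential s M N x)"
      unfolding g_def riesz_potential_def
      using has_bochner_integral_marginal[OF elim(2) fst] has_bochner_integral_marginal[OF elim(3) snd]
      by (rule has_bochner_integral_diff)
    then have gi: "(\<integral>p. g x p \<partial>(M \<Otimes>\<^sub>M N)) = riesz_potential s M N x"
      by (simp add: has_bochner_integral_iff)
    have "(\<integral>q. g x (fst q) * g x (snd q) \<partial>?PP) = (\<integral>p. (\<integral>p'. g x p * g x p' \<partial>(M \<Otimes>\<^sub>M N)) \<partial>(M \<Otimes>\<^sub>M N))"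
      using PP.integral_fst'[OF elim(1)] by simp
    then show ?case by (simp add: gi power2_eq_square)
  qed
  have "has_bochner_integral lborel (\<lambda>x. \<integral>q. g x (fst q) * g x (snd q) \<partial>?PP)
    ((mean_distance \<gamma> M N + mean_distance \<gamma> N M - mean_distance \<gamma> M M - mean_distance \<gamma> N N) / c)"
    using X.integrable_fst[OF int] X.Fubini_integral[OF int]
    unfolding has_bochner_integral_integral_eq[OF prod] has_bochner_integral_integral_eq[OF total]
    by (simp add: has_bochner_integral_iff)
  moreover have "(\<lambda>x. (riesz_potential s M N x)\<^sup>2) \<in> borel_measurable lborel"
    unfolding riesz_potential_def by measurable
  moreover have "(\<lambda>x. \<integral>q. g x (fst q) * g x (snd q) \<partial>?PP) \<in> borel_measurable lborel"
    by measurable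
  ultimately have "has_bochner_integral lborel (\<lambda>x. (riesz_potential s M N x)\<^sup>2)
    ((mean_distance \<gamma> M N + mean_distance \<gamma> N M - mean_distance \<gamma> M M - mean_distance \<gamma> N N) / c)"
    using pot by (subst has_bochner_integral_cong_AE[symmetric]) auto
  moreover have "mean_distance \<gamma> N M = mean_distance \<gamma> M N"
    using M N M.sigma_finite_measure_axioms N.sigma_finite_measure_axioms by (intro mean_distance_commute)
  ultimately show ?thesis by (simp add: s_def c_def)
qed

text \<open>The integrability conjunct ensures that \<open>L2_norm\<close> is the genuine norm here
  and not the default value 0 of a divergent Bochner integral.\<close>

theorem proposition3:
  fixes \<mu> \<nu> :: "'a::euclidean_space measure" and \<gamma> :: real
  assumes "0 < \<gamma>" and "\<gamma> < min (real DIM('a)) 2"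
    and "prob_space \<mu>" and "sets \<mu> = sets borel" and "compactly_supported \<mu>"
    and "prob_space \<nu>" and "sets \<nu> = sets borel" and "compactly_supported \<nu>"
  shows "integrable lborel (\<lambda>x. (riesz_potential ((real DIM('a) + \<gamma>) / 2) \<mu> \<nu> x)\<^sup>2) \<and>
    energy_distance \<gamma> \<mu> \<nu> =
      (2 * pi) powr (real DIM('a) / 2) * sqrt (F_const \<gamma> DIM('a))
      * L2_norm (riesz_potential ((real DIM('a) + \<gamma>) / 2) \<mu> \<nu>)"
proof -
  let ?D = "2 * mean_distance \<gamma> \<mu> \<nu> - mean_distance \<gamma> \<mu> \<mu> - mean_distance \<gamma> \<nu> \<nu>"
  let ?c = "(2 * pi) powr real DIM('a) * F_const \<gamma> DIM('a)"
  have \<gamma>: "0 < \<gamma>" "\<gamma> < 2" "\<gamma> < real DIM('a)" using assms(1,2) by simp_all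
  note I = riesz_potential_sq_integral[OF \<gamma> assms(3-8)]
  have "F_const \<gamma> DIM('a) > 0"
    using \<gamma> by (simp add: F_const_def)
  \<comment> \<open>Positivity of \<open>F_const\<close> permits division by \<open>?c\<close>. The
    root is then distributed by \<open>real_sqrt_mult\<close>, which holds for all reals, so the
    sign of \<open>?D\<close> need not be discussed.\<close>
  then have "?D = ?c * (?D / ?c)" by simp
  then have "sqrt ?D = sqrt ((2 * pi) powr real DIM('a)) * sqrt (F_const \<gamma> DIM('a)) * sqrt (?D / ?c)"
    by (metis real_sqrt_mult)
  also have "sqrt ((2 * pi) powr real DIM('a)) = (2 * pi) powr (real DIM('a) / 2)"
    by (simp add: powr_half_sqrt[symmetric] powr_powr)
  also have "sqrt (?D / ?c) = L2_norm (riesz_potential ((real DIM('a) + \<gamma>) / 2) \<mu> \<nu>)"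
    using I by (simp add: L2_norm_def has_bochner_integral_iff)
  finally show ?thesis
    using I energy_distance_eq[OF assms(3-8) less_imp_le[OF \<gamma>(1)]] by (simp add: has_bochner_integral_iff)
qed

end
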